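(* Let $G$ be a finite group, $A$ an abelian group and $\ell:\mathbb{N}^+\to\mathbb{K}^\times$ a monoid homomorphism that is algebraically independent with respect to $G$. Then $S^1_{1,1}$ is simple as a $\mathbb{K}_\ell\Lambda^A_G$-module.
   Context: $\mathbb{K}$ is a field of characteristic zero with sufficiently many roots of unity (one may take: primitive roots of unity of every order). $A$ is written multiplicatively. All modules are left modules. For a finite group $F$, $F^*=\mathrm{Hom}(F,A)$. For a monoid homomorphism $\ell:\mathbb{N}^+\to\mathbb{K}^\times$ (from the multiplicative monoid of positive integers) and a finite group $X$, $\ell(X)=\ell(|X|)$. $\ell$ is algebraically independent with respect to $G$ if the elements $\ell(p)$, $p$ running over the prime divisors of $|G|$, are algebraically independent over $\mathbb{Q}\subseteq\mathbb{K}$. For $U\le G\times G$: $p_1(U),p_2(U)$ are the images of $U$ under the two coordinate projections, $k_1(U)=\{u\in G:(u,1)\in U\}$, $k_2(U)=\{u\in G:(1,u)\in U\}$. For $U,V\le G\times G$, $U\ast V=\{(u,v): \exists g\in G,\ (u,g)\in U,\ (g,v)\in V\}$. A subcharacter of $G\times G$ is a pair $(U,\varphi)$ with $U\le G\times G$ and $\varphi\in U^*$. Write $(U,\varphi)\sim(V,\psi)$ if $\varphi(1,g)\psi(g,1)=1$ for all $g\in k_2(U)\cap k_1(V)$; in that case $\varphi\ast\psi\in(U\ast V)^*$ is defined by $(\varphi\ast\psi)(u,v)=\varphi(u,g)\psi(g,v)$ for any $g$ with $(u,g)\in U,(g,v)\in V$. The $\ell$-deformed subcharacter algebra $\mathbb{K}_\ell\Lambda^A_G$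 is the associative unital $\mathbb{K}$-algebra with $\mathbb{K}$-basis the symbols $s^{G,G}_{U,\varphi}$, indexed by all subcharacters of $G\times G$, and multiplication $s^{G,G}_{U,\varphi}s^{G,G}_{V,\psi}=\ell(k_2(U)\cap k_1(V))\,s^{G,G}_{U\ast V,\varphi\ast\psi}$ if $(U,\varphi)\sim(V,\psi)$, and $0$ otherwise. $S^1_{1,1}$ is the submodule of the regular left module $\mathbb{K}_\ell\Lambda^A_G$ with $\mathbb{K}$-basis $\{s^{G,G}_{E\times 1,\varphi}: E\le G,\ \varphi\in E^*\}$, where $\varphi\in E^*$ is regarded as a character of $E\times 1$. *)

theory Defs
  imports
    Complex_Main
    "HOL-Algebra.Coset"
    "HOL-Algebra.Module"
    "HOL-Computational_Algebra.Primes"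
    "HOL-Library.Poly_Mapping"
begin

section \<open>Simple left modules over non-commutative rings\<close>

text \<open>The locale \<^locale>\<open>module\<close> requires a commutative ring of scalars; the following is
  the same notion over an arbitrary unital ring.  The \<^const>\<open>monoid.mult\<close> and \<^const>\<open>monoid.one\<close>
  fields of the module record are irrelevant.\<close>

locale left_module = R?: ring R + M?: abelian_group M
  for R :: "('r, 'x) ring_scheme" (structure) and M :: "('r, 'm, 'y) module_scheme" (structure) +
  assumes smult_closed:
      "\<lbrakk>a \<in> carrier R; x \<in> carrier M\<rbrakk> \<Longrightarrow> a \<odot>\<^bsub>M\<^esub> x \<in> carrier M"
    and smult_l_distr:
      "\<lbrakk>a \<in> carrier R; b \<in> carrier R; x \<in> carrier M\<rbrakk> \<Longrightarrow>
        (a \<oplus>\<^bsub>R\<^esub> b) \<odot>\<^bsub>M\<^esub> x = a \<odot>\<^bsub>M\<^esub> x \<oplus>\<^bsub>M\<^esub> b \<odot>\<^bsub>M\<^esub> x"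
    and smult_r_distr:
      "\<lbrakk>a \<in> carrier R; x \<in> carrier M; y \<in> carrier M\<rbrakk> \<Longrightarrow>
        a \<odot>\<^bsub>M\<^esub> (x \<oplus>\<^bsub>M\<^esub> y) = a \<odot>\<^bsub>M\<^esub> x \<oplus>\<^bsub>M\<^esub> a \<odot>\<^bsub>M\<^esub> y"
    and smult_assoc1:
      "\<lbrakk>a \<in> carrier R; b \<in> carrier R; x \<in> carrier M\<rbrakk> \<Longrightarrow>
        (a \<otimes>\<^bsub>R\<^esub> b) \<odot>\<^bsub>M\<^esub> x = a \<odot>\<^bsub>M\<^esub> (b \<odot>\<^bsub>M\<^esub> x)"
    and smult_one: "x \<in> carrier M \<Longrightarrow> \<one>\<^bsub>R\<^esub> \<odot>\<^bsub>M\<^esub> x = x"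

definition simple_left_module :: "('r, 'x) ring_scheme \<Rightarrow> ('r, 'm, 'y) module_scheme \<Rightarrow> bool" where
  "simple_left_module R M \<longleftrightarrow>
     left_module R M \<and> carrier M \<noteq> {\<zero>\<^bsub>M\<^esub>} \<and>
     (\<forall>N. submodule N R M \<longrightarrow> N = {\<zero>\<^bsub>M\<^esub>} \<or> N = carrier M)"

definition regular_left_module :: "'r ring \<Rightarrow> ('r, 'r) module" where
  "regular_left_module R =
     \<lparr>carrier = carrier R, monoid.mult = monoid.mult R, one = one R, zero = zero R, add = add R,
      smult = monoid.mult R\<rparr>"


section \<open>Hypotheses on the field and on the deformation parameter\<close>

definition has_all_primitive_roots_of_unity :: "'k::field itself \<Rightarrow> bool" where
  "has_all_primitive_roots_of_unity _ \<longleftrightarrow>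
     (\<forall>n>0. \<exists>\<zeta>::'k. \<zeta> ^ n = 1 \<and> (\<forall>m. 0 < m \<and> m < n \<longrightarrow> \<zeta> ^ m \<noteq> 1))"

text \<open>The positive integers are modelled as the nonzero elements of \<^typ>\<open>nat\<close>;
  the value at \<open>0\<close> is arbitrary and never used.\<close>

definition pos_monoid_hom :: "(nat \<Rightarrow> 'k::field) \<Rightarrow> bool" where
  "pos_monoid_hom l \<longleftrightarrow>
     (\<forall>n>0. l n \<noteq> 0) \<and> l 1 = 1 \<and> (\<forall>m>0. \<forall>n>0. l (m * n) = l m * l n)"

text \<open>Polynomials over the rationals in indeterminates indexed by \<^typ>\<open>'i\<close>: finitely supported
  maps from monomials (finitely supported exponent vectors) to coefficients.\<close>

definition eval_mpoly :: "('i \<Rightarrow> 'k::field_char_0) \<Rightarrow> (('i \<Rightarrow>\<^sub>0 nat) \<Rightarrow>\<^sub>0 rat) \<Rightarrow> 'k" where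
  "eval_mpoly x P =
     (\<Sum>m\<in>Poly_Mapping.keys P. of_rat (Poly_Mapping.lookup P m) *
        (\<Prod>i\<in>Poly_Mapping.keys m. x i ^ Poly_Mapping.lookup m i))"

definition alg_independent_over_rat :: "'i set \<Rightarrow> ('i \<Rightarrow> 'k::field_char_0) \<Rightarrow> bool" where
  "alg_independent_over_rat I x \<longleftrightarrow>
     (\<forall>P. (\<forall>m\<in>Poly_Mapping.keys P. Poly_Mapping.keys m \<subseteq> I) \<and> eval_mpoly x P = 0 \<longrightarrow> P = 0)"

definition alg_independent_wrt :: "(nat \<Rightarrow> 'k::field_char_0) \<Rightarrow> ('g, 'x) monoid_scheme \<Rightarrow> bool" where
  "alg_independent_wrt l G \<longleftrightarrow> alg_independent_over_rat {p. prime p \<and> p dvd order G} l"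


section \<open>Subcharacters\<close>

text \<open>Homomorphisms are taken to be \<^const>\<open>extensional\<close>, so that two characters of \<open>F\<close> are
  equal as HOL functions iff they agree on \<open>F\<close>.\<close>

definition characters :: "('f, 'x) monoid_scheme \<Rightarrow> ('a, 'y) monoid_scheme \<Rightarrow> 'f set \<Rightarrow> ('f \<Rightarrow> 'a) set" where
  "characters H A F = hom (H\<lparr>carrier := F\<rparr>) A \<inter> extensional F"

type_synonym ('g, 'a) subchar = "('g \<times> 'g) set \<times> ('g \<times> 'g \<Rightarrow> 'a)"

definition subcharacters :: "('g, 'x) monoid_scheme \<Rightarrow> ('a, 'y) monoid_scheme \<Rightarrow> ('g, 'a) subchar set" where
  "subcharacters G A =
     {(U, \<phi>). subgroup U (G \<times>\<times> G) \<and> \<phi> \<in> characters (G \<times>\<times> G) A U}"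

definition k1 :: "('g, 'x) monoid_scheme \<Rightarrow> ('g \<times> 'g) set \<Rightarrow> 'g set" where
  "k1 G U = {u \<in> carrier G. (u, \<one>\<^bsub>G\<^esub>) \<in> U}"

definition k2 :: "('g, 'x) monoid_scheme \<Rightarrow> ('g \<times> 'g) set \<Rightarrow> 'g set" where
  "k2 G U = {u \<in> carrier G. (\<one>\<^bsub>G\<^esub>, u) \<in> U}"

definition star_prod :: "('g, 'x) monoid_scheme \<Rightarrow> ('g \<times> 'g) set \<Rightarrow> ('g \<times> 'g) set \<Rightarrow> ('g \<times> 'g) set" where
  "star_prod G U V = {(u, v). \<exists>g\<in>carrier G. (u, g) \<in> U \<and> (g, v) \<in> V}"

definition compatible ::
  "('g, 'x) monoid_scheme \<Rightarrow> ('a, 'y) monoid_scheme \<Rightarrow> ('g, 'a) subchar \<Rightarrow> ('g, 'a) subchar \<Rightarrow> bool" where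
  "compatible G A = (\<lambda>(U, \<phi>) (V, \<psi>).
     \<forall>g \<in> k2 G U \<inter> k1 G V. \<phi> (\<one>\<^bsub>G\<^esub>, g) \<otimes>\<^bsub>A\<^esub> \<psi> (g, \<one>\<^bsub>G\<^esub>) = \<one>\<^bsub>A\<^esub>)"

definition star_char ::
  "('g, 'x) monoid_scheme \<Rightarrow> ('a, 'y) monoid_scheme \<Rightarrow> ('g, 'a) subchar \<Rightarrow> ('g, 'a) subchar \<Rightarrow> ('g \<times> 'g \<Rightarrow> 'a)" where
  "star_char G A = (\<lambda>(U, \<phi>) (V, \<psi>). restrict
     (\<lambda>(u, v). let g = (SOME g. g \<in> carrier G \<and> (u, g) \<in> U \<and> (g, v) \<in> V)
               in \<phi> (u, g) \<otimes>\<^bsub>A\<^esub> \<psi> (g, v))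
     (star_prod G U V))"

text \<open>For compatible subcharacters the choice of the middle element in
  \<^const>\<open>star_char\<close> is immaterial.\<close>

lemma star_char_eq:
  fixes G (structure)
  assumes "group G" "comm_group A"
    and "(U, \<phi>) \<in> subcharacters G A" "(V, \<psi>) \<in> subcharacters G A"
    and "compatible G A (U, \<phi>) (V, \<psi>)"
    and g: "g \<in> carrier G" "(u, g) \<in> U" "(g, v) \<in> V"
  shows "star_char G A (U, \<phi>) (V, \<psi>) (u, v) = \<phi> (u, g) \<otimes>\<^bsub>A\<^esub> \<psi> (g, v)"
proof -
  interpret G: group G by fact
  interpret A: comm_group A by fact
  interpret GG: group "G \<times>\<times> G" by (rule DirProd_group) fact+
  have U: "subgroup U (G \<times>\<times> G)" and V: "subgroup V (G \<times>\<times> G)"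
    and phi: "\<phi> \<in> hom ((G \<times>\<times> G)\<lparr>carrier := U\<rparr>) A"
    and psi: "\<psi> \<in> hom ((G \<times>\<times> G)\<lparr>carrier := V\<rparr>) A"
    using assms(3,4) by (auto simp: subcharacters_def characters_def)
  define h where "h = (SOME h. h \<in> carrier G \<and> (u, h) \<in> U \<and> (h, v) \<in> V)"
  have h: "h \<in> carrier G" "(u, h) \<in> U" "(h, v) \<in> V"
    using someI[of "\<lambda>h. h \<in> carrier G \<and> (u, h) \<in> U \<and> (h, v) \<in> V" g] g
    unfolding h_def by auto
  have uv: "u \<in> carrier G" "v \<in> carrier G"
    using subgroup.subset[OF U] subgroup.subset[OF V] g by (auto simp: DirProd_def)
  let ?k = "inv g \<otimes> h"
  have k: "?k \<in> carrier G" using g h by simp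
  have "inv\<^bsub>G \<times>\<times> G\<^esub> (u, g) \<otimes>\<^bsub>G \<times>\<times> G\<^esub> (u, h) \<in> U"
    using U g h by (simp add: subgroup.m_closed subgroup.m_inv_closed)
  then have kU: "(\<one>, ?k) \<in> U"
    using uv g h assms(1) by (simp add: inv_DirProd)
  have "inv\<^bsub>G \<times>\<times> G\<^esub> (g, v) \<otimes>\<^bsub>G \<times>\<times> G\<^esub> (h, v) \<in> V"
    using V g h by (simp add: subgroup.m_closed subgroup.m_inv_closed)
  then have kV: "(?k, \<one>) \<in> V"
    using uv g h assms(1) by (simp add: inv_DirProd)
  have gk: "g \<otimes> ?k = h" using g h by (simp add: G.m_assoc[symmetric])
  have 1: "\<phi> (u, h) = \<phi> (u, g) \<otimes>\<^bsub>A\<^esub> \<phi> (\<one>, ?k)"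
    using hom_mult[OF phi, of "(u, g)" "(\<one>, ?k)"] g kU uv gk by simp
  have 2: "\<psi> (h, v) = \<psi> (g, v) \<otimes>\<^bsub>A\<^esub> \<psi> (?k, \<one>)"
    using hom_mult[OF psi, of "(g, v)" "(?k, \<one>)"] g kV uv gk by simp
  have 3: "\<phi> (\<one>, ?k) \<otimes>\<^bsub>A\<^esub> \<psi> (?k, \<one>) = \<one>\<^bsub>A\<^esub>"
    using assms(5) k kU kV by (auto simp: compatible_def k1_def k2_def)
  have c: "\<phi> (u, g) \<in> carrier A" "\<phi> (\<one>, ?k) \<in> carrier A"
    "\<psi> (g, v) \<in> carrier A" "\<psi> (?k, \<one>) \<in> carrier A"
    using hom_in_carrier[OF phi] hom_in_carrier[OF psi] g kU kV by auto
  have "\<phi> (u, h) \<otimes>\<^bsub>A\<^esub> \<psi> (h, v)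
      = (\<phi> (u, g) \<otimes>\<^bsub>A\<^esub> \<psi> (g, v)) \<otimes>\<^bsub>A\<^esub> (\<phi> (\<one>, ?k) \<otimes>\<^bsub>A\<^esub> \<psi> (?k, \<one>))"
    unfolding 1 2 using c by (simp add: A.m_ac)
  also have "\<dots> = \<phi> (u, g) \<otimes>\<^bsub>A\<^esub> \<psi> (g, v)" unfolding 3 using c by simp
  finally have "\<phi> (u, h) \<otimes>\<^bsub>A\<^esub> \<psi> (h, v) = \<phi> (u, g) \<otimes>\<^bsub>A\<^esub> \<psi> (g, v)" .
  moreover have "(u, v) \<in> star_prod G U V" using g by (auto simp: star_prod_def)
  ultimately show ?thesis
    by (simp add: star_char_def h_def Let_def)
qed


section \<open>The deformed subcharacter algebra\<close>

text \<open>The free \<open>\<bbbK>\<close>-vector space on the subcharacters consists of the finitely supported maps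
  with support in \<^const>\<open>subcharacters\<close>; the basis vector belonging to \<open>s\<close> is
  \<^term>\<open>Poly_Mapping.single s 1\<close>.  The multiplication is the bilinear extension of the product of basis
  vectors.  The action of a scalar \<open>c\<close> is multiplication by \<open>c\<close> times the unit, so that submodules
  over the ring are automatically \<open>\<bbbK>\<close>-subspaces.\<close>

definition subchar_mult ::
  "('g, 'x) monoid_scheme \<Rightarrow> ('a, 'y) monoid_scheme \<Rightarrow> (nat \<Rightarrow> 'k::field) \<Rightarrow>
   (('g, 'a) subchar \<Rightarrow>\<^sub>0 'k) \<Rightarrow> (('g, 'a) subchar \<Rightarrow>\<^sub>0 'k) \<Rightarrow> (('g, 'a) subchar \<Rightarrow>\<^sub>0 'k)" where
  "subchar_mult G A l x y =
     (\<Sum>s\<in>Poly_Mapping.keys x. \<Sum>t\<in>Poly_Mapping.keys y.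
        if compatible G A s t
        then Poly_Mapping.single (star_prod G (fst s) (fst t), star_char G A s t)
               (Poly_Mapping.lookup x s * Poly_Mapping.lookup y t *
                  l (card (k2 G (fst s) \<inter> k1 G (fst t))))
        else 0)"

definition diag_subchar :: "('g, 'x) monoid_scheme \<Rightarrow> ('a, 'y) monoid_scheme \<Rightarrow> ('g, 'a) subchar" where
  "diag_subchar G A =
     (let D = {(g, g) | g. g \<in> carrier G} in (D, restrict (\<lambda>_. \<one>\<^bsub>A\<^esub>) D))"

definition subchar_algebra ::
  "('g, 'x) monoid_scheme \<Rightarrow> ('a, 'y) monoid_scheme \<Rightarrow> (nat \<Rightarrow> 'k::field) \<Rightarrow>
   (('g, 'a) subchar \<Rightarrow>\<^sub>0 'k) ring" where
  "subchar_algebra G A l =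
     \<lparr>carrier = {x. Poly_Mapping.keys x \<subseteq> subcharacters G A},
      monoid.mult = subchar_mult G A l,
      one = Poly_Mapping.single (diag_subchar G A) 1,
      zero = 0,
      add = (+)\<rparr>"

definition left_subcharacters :: "('g, 'x) monoid_scheme \<Rightarrow> ('a, 'y) monoid_scheme \<Rightarrow> ('g, 'a) subchar set" where
  "left_subcharacters G A =
     {(E \<times> {\<one>\<^bsub>G\<^esub>}, restrict (\<lambda>(e, _). \<phi> e) (E \<times> {\<one>\<^bsub>G\<^esub>})) | E \<phi>.
        subgroup E G \<and> \<phi> \<in> characters G A E}"

definition S11 ::
  "('g, 'x) monoid_scheme \<Rightarrow> ('a, 'y) monoid_scheme \<Rightarrow> (nat \<Rightarrow> 'k::field) \<Rightarrow>
   (('g, 'a) subchar \<Rightarrow>\<^sub>0 'k, ('g, 'a) subchar \<Rightarrow>\<^sub>0 'k) module" where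
  "S11 G A l =
     (regular_left_module (subchar_algebra G A l))
       \<lparr>carrier := {x. Poly_Mapping.keys x \<subseteq> left_subcharacters G A}\<rparr>"

end

theory Submission
  imports Defs "Jordan_Normal_Form.Determinant"
begin

text \<open>An element \<open>s\<close> attached to \<open>E \<times> F\<close> with character \<open>\<alpha> \<times> \<beta>\<inverse>\<close> sends the basis vector of
  \<open>(H, \<psi>)\<close> to a multiple of the basis vector of \<open>(E, \<alpha>)\<close>; the factor is \<open>\<ell>(F \<inter> H)\<close> if \<open>\<beta>\<close>
  and \<open>\<psi>\<close> agree on \<open>F \<inter> H\<close> and zero otherwise, independently of \<open>(E, \<alpha>)\<close>.  Simplicity thus amounts
  to nondegeneracy of the bilinear form with these values.  In the determinant of the form restricted to a finite
  set of pairs, the product of the diagonal entries is \<open>\<ell>(n)\<close> for the product \<open>n\<close> of the orders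
  of the subgroups, and any other permutation with nonzero contribution gives \<open>\<ell>(m)\<close> with
  \<open>m < n\<close>; as the values of \<open>\<ell>\<close> at distinct such integers are linearly independent
  over \<open>\<rat>\<close>, the determinant does not vanish.\<close>

hide_const (open) Polynomial.order

section \<open>Linear independence over \<rat> of the values of \<ell>\<close>

text \<open>The exponent vector of \<open>n\<close>, read as a monomial in indeterminates indexed by
  the primes. It turns a value of \<ell> at a positive integer into a monomial in the values of
  \<ell> at primes.\<close>

definition prime_monomial :: "nat \<Rightarrow> nat \<Rightarrow>\<^sub>0 nat" where
  "prime_monomial n = Abs_poly_mapping (count (prime_factorization n))"

lemma lookup_prime_monomial [simp]:
  "Poly_Mapping.lookup (prime_monomial n) = count (prime_factorization n)"
  unfolding prime_monomial_def by (subst lookup_Abs_poly_mapping) simp_all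

lemma keys_prime_monomial [simp]: "Poly_Mapping.keys (prime_monomial n) = prime_factors n"
  by (rule Set.set_eqI) (simp add: in_keys_iff)

text \<open>Unique factorisation. Zero is left out because its \<open>prime_factorization\<close> is
  empty by convention, just like that of 1.\<close>

lemma inj_on_prime_monomial: "inj_on prime_monomial {0<..}"
proof (rule inj_onI)
  fix m n :: nat
  assume mn: "m \<in> {0<..}" "n \<in> {0<..}" and "prime_monomial m = prime_monomial n"
  then have "prime_factorization m = prime_factorization n"
    by (metis lookup_prime_monomial multiset_eqI)
  then show "m = n"
    using mn by (metis greaterThan_iff prod_mset_prime_factorization_nat)
qed

context
  fixes l :: "nat \<Rightarrow> 'k::field"
  assumes l: "pos_monoid_hom l"
begin

lemma pos_monoid_hom_power: "n > 0 \<Longrightarrow> l (n ^ k) = l n ^ k"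
  using l by (induction k) (auto simp: pos_monoid_hom_def)

lemma pos_monoid_hom_prod:
  "(\<And>x. x \<in> X \<Longrightarrow> f x > 0) \<Longrightarrow> l (\<Prod>x\<in>X. f x) = (\<Prod>x\<in>X. l (f x))"
  using l by (induction X rule: infinite_finite_induct) (auto simp: pos_monoid_hom_def prod_pos)

text \<open>The right-hand side is \<open>prime_monomial n\<close> evaluated at \<ell>, in the shape
  in which \<open>eval_mpoly\<close> produces it.\<close>

lemma pos_monoid_hom_prime_factors:
  assumes "n > 0"
  shows "l n = (\<Prod>p\<in>prime_factors n. l p ^ count (prime_factorization n) p)"
proof -
  have "l n = l (\<Prod>p\<in>prime_factors n. p ^ multiplicity p n)"
    using prime_factorization_nat assms by simp
  also have "\<dots> = (\<Prod>p\<in>prime_factors n. l (p ^ multiplicity p n))"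
    by (rule pos_monoid_hom_prod) (auto simp: prime_factors_gt_0_nat)
  also have "\<dots> = (\<Prod>p\<in>prime_factors n. l p ^ count (prime_factorization n) p)"
    by (rule prod.cong)
      (auto simp: pos_monoid_hom_power prime_factors_gt_0_nat count_prime_factorization)
  finally show ?thesis .
qed

end

text \<open>A rational linear relation between values of \<ell> is a polynomial relation between its
  values at primes. Distinct integers give distinct monomials, so nothing cancels and the
  coefficients of the polynomial \<open>P\<close> are exactly the \<open>c n\<close>.\<close>

lemma alg_independent_linear_independent:
  fixes l :: "nat \<Rightarrow> 'k::field_char_0"
  assumes l: "pos_monoid_hom l" and ind: "alg_independent_over_rat I l"
    and T: "finite T" "\<And>n. n \<in> T \<Longrightarrow> n > 0 \<and> prime_factors n \<subseteq> I"
    and sum0: "(\<Sum>n\<in>T. of_rat (c n) * l n) = 0"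
    and n: "n \<in> T"
  shows "c n = 0"
proof -
  define P where "P = (\<Sum>n\<in>T. Poly_Mapping.single (prime_monomial n) (c n))"
  have inj: "inj_on prime_monomial T"
    using inj_on_prime_monomial by (rule inj_on_subset) (use T in auto)
  have lookup_P: "Poly_Mapping.lookup P (prime_monomial m) = c m" if "m \<in> T" for m
  proof -
    have "Poly_Mapping.lookup P (prime_monomial m) = (\<Sum>n\<in>T. if n = m then c n else 0)"
      unfolding P_def lookup_sum using inj that
      by (intro sum.cong) (auto simp: lookup_single when_def inj_on_def)
    also have "\<dots> = c m"
      using T(1) that by simp
    finally show ?thesis .
  qed
  have keys_P: "Poly_Mapping.keys P \<subseteq> prime_monomial ` T"
    unfolding P_def by (rule order_trans[OF keys_sum]) auto
  have "eval_mpoly l P = (\<Sum>m\<in>prime_monomial ` T. of_rat (Poly_Mapping.lookup P m) *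
        (\<Prod>i\<in>Poly_Mapping.keys m. l i ^ Poly_Mapping.lookup m i))"
    unfolding eval_mpoly_def
    by (rule sum.mono_neutral_left) (use T(1) keys_P in \<open>auto simp: in_keys_iff\<close>)
  also have "\<dots> = (\<Sum>n\<in>T. of_rat (c n) * l n)"
    unfolding sum.reindex[OF inj]
    by (rule sum.cong) (use T(2) lookup_P pos_monoid_hom_prime_factors[OF l] in auto)
  finally have "eval_mpoly l P = 0"
    using sum0 by simp
  moreover have "\<forall>m\<in>Poly_Mapping.keys P. Poly_Mapping.keys m \<subseteq> I"
    using keys_P T(2) by fastforce
  ultimately have "P = 0"
    using ind unfolding alg_independent_over_rat_def by blast
  then show ?thesis
    using lookup_P[OF n] by simp
qed

section \<open>Nondegeneracy of the agreement form\<close>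

text \<open>The bilinear form on pairs of a subgroup and a character. It appears later as the
  structure constant with which \<open>product_subchar r s\<close> multiplies
  \<open>left_subchar t\<close>, for every \<open>r\<close>.\<close>

definition agreement_form :: "(nat \<Rightarrow> 'k::zero) \<Rightarrow> 'g set \<times> ('g \<Rightarrow> 'a) \<Rightarrow> 'g set \<times> ('g \<Rightarrow> 'a) \<Rightarrow> 'k" where
  "agreement_form l s t =
     (if \<forall>g\<in>fst s \<inter> fst t. snd s g = snd t g then l (card (fst s \<inter> fst t)) else 0)"

text \<open>No inclusion can be strict: passing from \<open>i\<close> to \<open>p i\<close> never
  decreases a cardinality, while the sum of all cardinalities is invariant under the
  permutation.\<close>

lemma permutes_subset_all_eq:
  assumes p: "p permutes I" and I: "finite I"
    and fin: "\<And>i. i \<in> I \<Longrightarrow> finite (F i)" and sub: "\<And>i. i \<in> I \<Longrightarrow> F i \<subseteq> F (p i)"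
    and i: "i \<in> I"
  shows "F (p i) = F i"
proof -
  have pI: "p j \<in> I" if "j \<in> I" for j
    using permutes_in_image[OF p] that by simp
  have "(\<Sum>i\<in>I. card (F i)) = (\<Sum>i\<in>I. card (F (p i)))"
    using sum.permute[OF p, of "\<lambda>i. card (F i)"] by (simp add: o_def)
  moreover have "\<And>i. i \<in> I \<Longrightarrow> card (F i) \<le> card (F (p i))"
    by (intro card_mono fin sub pI)
  ultimately have "card (F i) = card (F (p i))"
    using sum_mono_inv[of "\<lambda>i. card (F i)" I "\<lambda>i. card (F (p i))"] I i by blast
  then show ?thesis
    using card_subset_eq[OF fin[OF pI[OF i]] sub[OF i]] by simp
qed

text \<open>In the Leibniz expansion every permutation contributes zero or its sign times a value of
  \<ell>. If the sum vanished, linear independence would kill the total coefficient of each value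
  separately, but the coefficient belonging to the diagonal product is 1.\<close>

lemma det_agreement_form_nonzero:
  fixes G (structure) and l :: "nat \<Rightarrow> 'k::field_char_0"
  assumes "group G" and fin: "finite (carrier G)"
    and l: "pos_monoid_hom l" and ind: "alg_independent_wrt l G"
    and inj: "inj_on e {0..<n}"
    and e: "\<And>i. i < n \<Longrightarrow> subgroup (fst (e i)) G \<and> snd (e i) \<in> extensional (fst (e i))"
  shows "det (mat n n (\<lambda>(i, j). agreement_form l (e i) (e j))) \<noteq> 0"
proof
  interpret G: group G by fact
  let ?E = "\<lambda>i. fst (e i)"
  let ?P = "{p. p permutes {0..<n}}"
  \<comment> \<open>\<open>agree p\<close> says that the term of \<open>p\<close> in the expansion
    is nonzero. Its value is then \<open>l (N p)\<close> up to sign, and \<open>c m\<close> collects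
    the signs of all such terms with \<open>N p = m\<close>.\<close>
  define agree where "agree p \<longleftrightarrow>
    (\<forall>i<n. \<forall>g\<in>?E i \<inter> ?E (p i). snd (e i) g = snd (e (p i)) g)" for p
  define N where "N p = (\<Prod>i=0..<n. card (?E i \<inter> ?E (p i)))" for p
  define \<epsilon> where "\<epsilon> p = (if agree p then sign p else 0)" for p
  define T where "T = N ` ?P"
  define c where "c m = rat_of_int (\<Sum>p\<in>{p\<in>?P. N p = m}. \<epsilon> p)" for m
  have finP: "finite ?P"
    by (simp add: finite_permutations)
  have pn: "p i < n" if "p \<in> ?P" "i < n" for p i
    using permutes_in_image[of p "{0..<n}" i] that by auto
  have sub: "subgroup (?E i \<inter> ?E (p i)) G" if "p \<in> ?P" "i < n" for p i
    using e pn that by (intro G.subgroups_Inter_pair) auto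
  have finE: "finite (?E i)" if "i < n" for i
    using e[OF that] fin by (meson finite_subset subgroup.subset)
  have card_pos: "card (?E i \<inter> ?E (p i)) > 0" if "p \<in> ?P" "i < n" for p i
    using subgroup.finite_imp_card_positive[OF sub[OF that] fin] .
  have N_pos: "N p > 0" if "p \<in> ?P" for p
    unfolding N_def using card_pos[OF that] by (intro prod_pos) auto
  \<comment> \<open>Algebraic independence is assumed only for primes dividing the order of the
    group. By Lagrange, applied to the intersections of subgroups, no other primes occur in
    \<open>N p\<close>.\<close>
  have primes: "prime_factors (N p) \<subseteq> {q. prime q \<and> q dvd order G}" if "p \<in> ?P" for p
  proof
    fix q assume "q \<in> prime_factors (N p)"
    then have q: "prime q" and "q dvd N p"
      by (auto simp: prime_factors_dvd)
    then obtain i where i: "i < n" "q dvd card (?E i \<inter> ?E (p i))"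
      unfolding N_def by (auto simp: prime_dvd_prod_iff)
    have "card (?E i \<inter> ?E (p i)) dvd order G"
      using G.lagrange[OF sub[OF that i(1)]] by (metis dvd_triv_right)
    then show "q \<in> {q. prime q \<and> q dvd order G}"
      using q i dvd_trans by blast
  qed
  have entry: "(\<Prod>i=0..<n. mat n n (\<lambda>(i, j). agreement_form l (e i) (e j)) $$ (i, p i)) =
      (if agree p then l (N p) else 0)" if "p \<in> ?P" for p
  proof (cases "agree p")
    case True
    have "(\<Prod>i=0..<n. mat n n (\<lambda>(i, j). agreement_form l (e i) (e j)) $$ (i, p i)) =
        (\<Prod>i=0..<n. l (card (?E i \<inter> ?E (p i))))"
      using True pn[OF that] by (intro prod.cong) (auto simp: agreement_form_def agree_def)
    also have "\<dots> = l (N p)"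
      unfolding N_def using card_pos[OF that] by (subst pos_monoid_hom_prod[OF l]) auto
    finally show ?thesis
      using True by simp
  next
    case False
    then obtain i where "i < n" "\<exists>g\<in>?E i \<inter> ?E (p i). snd (e i) g \<noteq> snd (e (p i)) g"
      unfolding agree_def by blast
    then have "\<exists>i\<in>{0..<n}. mat n n (\<lambda>(i, j). agreement_form l (e i) (e j)) $$ (i, p i) = 0"
      using pn[OF that] by (intro bexI[of _ i]) (auto simp: agreement_form_def)
    then show ?thesis
      using False by (simp add: prod_zero)
  qed
  assume "det (mat n n (\<lambda>(i, j). agreement_form l (e i) (e j))) = 0"
  then have "0 = (\<Sum>p\<in>?P. signof p *
      (\<Prod>i=0..<n. mat n n (\<lambda>(i, j). agreement_form l (e i) (e j)) $$ (i, p i)))"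
    by (subst (asm) det_def'[where n = n]) auto
  also have "\<dots> = (\<Sum>p\<in>?P. of_int (\<epsilon> p) * l (N p))"
    by (rule sum.cong) (use entry in \<open>auto simp: \<epsilon>_def simp del: index_mat\<close>)
  also have "\<dots> = (\<Sum>m\<in>T. \<Sum>p\<in>{p\<in>?P. N p = m}. of_int (\<epsilon> p) * l (N p))"
    unfolding T_def by (rule sum.image_gen[OF finP])
  also have "\<dots> = (\<Sum>m\<in>T. of_rat (c m) * l m)"
    by (rule sum.cong) (auto simp: c_def of_rat_sum sum_distrib_right)
  finally have "(\<Sum>m\<in>T. of_rat (c m) * l m) = 0"
    by simp
  moreover have "N id \<in> T"
    by (auto simp: T_def permutes_id)
  ultimately have "c (N id) = 0"
    using alg_independent_linear_independent[OF l ind[unfolded alg_independent_wrt_def], of T c "N id"]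
      finP N_pos primes unfolding T_def by blast
  \<comment> \<open>Equality with the diagonal product makes every intersection equal to
    \<open>?E i\<close>. The resulting inclusions along the permutation are equalities, so agreement
    of the characters identifies \<open>e (p i)\<close> with \<open>e i\<close>, and injectivity of
    \<open>e\<close> finishes.\<close>
  moreover have "p = id" if p: "p \<in> ?P" and Np: "N p = N id" and agree: "agree p" for p
  proof -
    have le: "card (?E i \<inter> ?E (p i)) \<le> card (?E i)" if "i < n" for i
      using finE[OF that] by (intro card_mono) auto
    have card_eq: "card (?E i \<inter> ?E (p i)) = card (?E i)" if i: "i < n" for i
    proof (rule ccontr)
      assume "card (?E i \<inter> ?E (p i)) \<noteq> card (?E i)"
      then have lt: "card (?E i \<inter> ?E (p i)) < card (?E i)"
        using le[OF i] by simp
      have pos: "card (?E j) > 0" if "j < n" for j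
        using le[OF that] card_pos[OF p that] by linarith
      \<comment> \<open>One strictly smaller factor makes the whole product strictly smaller because
        all the other factors are positive.\<close>
      have "(\<Prod>i=0..<n. card (?E i \<inter> ?E (p i))) < (\<Prod>i=0..<n. card (?E i))"
        by (rule prod_mono_strict[of i]) (use i lt le pos in simp_all)
      then have "N p < N id"
        by (simp add: N_def)
      then show False
        using Np by simp
    qed
    have "?E i \<subseteq> ?E (p i)" if "i < n" for i
      using card_subset_eq[OF finE[OF that] _ card_eq[OF that]] by auto
    then have E: "?E (p i) = ?E i" if "i < n" for i
      using permutes_subset_all_eq[of p "{0..<n}" ?E i] p finE that by auto
    have "e (p i) = e i" if "i < n" for i
    proof (rule prod_eqI)
      show "snd (e (p i)) = snd (e i)"
        using agree e[OF that] e[OF pn[OF p that]] that E[OF that] unfolding agree_def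
        by (intro extensionalityI[of _ "?E i"]) auto
    qed (use E that in auto)
    then have "p i = i" if "i < n" for i
      using inj pn[OF p that] that by (auto simp: inj_on_def)
    moreover have "p i = i" if "\<not> i < n" for i
      using p that by (auto simp: permutes_def)
    ultimately show "p = id"
      by (metis eq_id_iff)
  qed
  \<comment> \<open>Only the identity survives in this class: it agrees with itself trivially and
    has sign 1.\<close>
  then have "(\<Sum>p\<in>{p\<in>?P. N p = N id}. \<epsilon> p) = (\<Sum>p\<in>{p\<in>?P. N p = N id}. if p = id then 1 else 0)"
    by (intro sum.cong) (auto simp: \<epsilon>_def agree_def)
  then have "c (N id) = 1"
    unfolding c_def using finP by (simp add: permutes_id)
  ultimately show False
    by simp
qed

lemma agreement_form_nondegenerate:
  fixes G (structure) and l :: "nat \<Rightarrow> 'k::field_char_0"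
  assumes "group G" "finite (carrier G)" "pos_monoid_hom l" "alg_independent_wrt l G"
    and S: "finite S" "\<And>s. s \<in> S \<Longrightarrow> subgroup (fst s) G \<and> snd s \<in> extensional (fst s)"
    and x: "\<And>s. s \<in> S \<Longrightarrow> (\<Sum>t\<in>S. agreement_form l s t * x t) = 0"
    and t: "t \<in> S"
  shows "x t = 0"
proof -
  define n where "n = card S"
  obtain e where e: "bij_betw e {0..<n} S"
    using ex_bij_betw_nat_finite[OF S(1)] unfolding n_def by blast
  then have eS: "e i \<in> S" if "i < n" for i
    using that by (auto simp: bij_betw_def)
  define M where "M = mat n n (\<lambda>(i, j). agreement_form l (e i) (e j))"
  define v where "v = vec n (\<lambda>i. x (e i))"
  have M: "M \<in> carrier_mat n n"
    by (simp add: M_def)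
  have "det M \<noteq> 0"
    unfolding M_def
    by (rule det_agreement_form_nonzero[OF assms(1-4)])
      (use e eS S(2) in \<open>auto simp: bij_betw_def\<close>)
  moreover have "M *\<^sub>v v = 0\<^sub>v n"
  proof (rule eq_vecI)
    fix i assume "i < dim_vec (0\<^sub>v n)"
    then have i: "i < n" by simp
    have "(M *\<^sub>v v) $ i = (\<Sum>j=0..<n. agreement_form l (e i) (e j) * x (e j))"
      using i by (simp add: M_def v_def scalar_prod_def)
    also have "\<dots> = (\<Sum>t\<in>S. agreement_form l (e i) t * x t)"
      by (rule sum.reindex_bij_betw[OF e])
    finally show "(M *\<^sub>v v) $ i = 0\<^sub>v n $ i"
      using x[OF eS[OF i]] i by simp
  qed (simp add: M_def)
  ultimately have "v = 0\<^sub>v n"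
    using det_0_iff_vec_prod_zero_field[OF M] unfolding v_def by (metis vec_carrier)
  moreover obtain i where i: "i < n" "t = e i"
    using t e by (auto simp: bij_betw_def)
  ultimately have "v $ i = 0"
    by simp
  then show ?thesis
    using i by (simp add: v_def)
qed

section \<open>Bilinear products given by structure constants on a basis\<close>

text \<open>A product of basis vectors is again a basis vector up to the scalar
  \<open>c s t\<close>. Vanishing products are encoded by a zero scalar, so \<open>\<mu>\<close> can
  be total.\<close>

definition twisted_mult ::
  "('b \<Rightarrow> 'b \<Rightarrow> 'b) \<Rightarrow> ('b \<Rightarrow> 'b \<Rightarrow> 'k::comm_ring_1) \<Rightarrow> ('b \<Rightarrow>\<^sub>0 'k) \<Rightarrow> ('b \<Rightarrow>\<^sub>0 'k) \<Rightarrow> ('b \<Rightarrow>\<^sub>0 'k)" where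
  "twisted_mult \<mu> c x y =
     (\<Sum>s\<in>Poly_Mapping.keys x. \<Sum>t\<in>Poly_Mapping.keys y.
        Poly_Mapping.single (\<mu> s t) (Poly_Mapping.lookup x s * Poly_Mapping.lookup y t * c s t))"

context
  fixes \<mu> :: "'b \<Rightarrow> 'b \<Rightarrow> 'b" and c :: "'b \<Rightarrow> 'b \<Rightarrow> 'k::comm_ring_1"
begin

text \<open>The support of a sum may be smaller than the union of the supports. With index sets that
  do not depend on the arguments, bilinearity can be read off term by term.\<close>

lemma twisted_mult_superset:
  assumes "finite S" "Poly_Mapping.keys x \<subseteq> S" "finite T" "Poly_Mapping.keys y \<subseteq> T"
  shows "twisted_mult \<mu> c x y =
    (\<Sum>s\<in>S. \<Sum>t\<in>T. Poly_Mapping.single (\<mu> s t) (Poly_Mapping.lookup x s * Poly_Mapping.lookup y t * c s t))"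
proof -
  have "twisted_mult \<mu> c x y = (\<Sum>s\<in>Poly_Mapping.keys x. \<Sum>t\<in>T.
      Poly_Mapping.single (\<mu> s t) (Poly_Mapping.lookup x s * Poly_Mapping.lookup y t * c s t))"
    unfolding twisted_mult_def using assms
    by (intro sum.cong sum.mono_neutral_left refl) (auto simp: in_keys_iff)
  also have "\<dots> = (\<Sum>s\<in>S. \<Sum>t\<in>T.
      Poly_Mapping.single (\<mu> s t) (Poly_Mapping.lookup x s * Poly_Mapping.lookup y t * c s t))"
    using assms by (intro sum.mono_neutral_left) (auto simp: in_keys_iff)
  finally show ?thesis .
qed

lemma twisted_mult_add_left:
  "twisted_mult \<mu> c (x + x') y = twisted_mult \<mu> c x y + twisted_mult \<mu> c x' y"
proof -
  let ?S = "Poly_Mapping.keys x \<union> Poly_Mapping.keys x'" and ?T = "Poly_Mapping.keys y"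
  show ?thesis
    using keys_add[of x x']
    by (simp add: twisted_mult_superset[of ?S _ ?T] lookup_add distrib_right single_add sum.distrib)
qed

lemma twisted_mult_add_right:
  "twisted_mult \<mu> c x (y + y') = twisted_mult \<mu> c x y + twisted_mult \<mu> c x y'"
proof -
  let ?S = "Poly_Mapping.keys x" and ?T = "Poly_Mapping.keys y \<union> Poly_Mapping.keys y'"
  show ?thesis
    using keys_add[of y y']
    by (simp add: twisted_mult_superset[of ?S _ ?T] lookup_add distrib_right distrib_left single_add sum.distrib)
qed

lemma twisted_mult_zero [simp]: "twisted_mult \<mu> c 0 y = 0" "twisted_mult \<mu> c x 0 = 0"
  by (simp_all add: twisted_mult_def)

lemma twisted_mult_sum_left:
  "twisted_mult \<mu> c (\<Sum>i\<in>I. f i) y = (\<Sum>i\<in>I. twisted_mult \<mu> c (f i) y)"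
  by (induction I rule: infinite_finite_induct) (simp_all add: twisted_mult_add_left)

lemma twisted_mult_sum_right:
  "twisted_mult \<mu> c x (\<Sum>i\<in>I. f i) = (\<Sum>i\<in>I. twisted_mult \<mu> c x (f i))"
  by (induction I rule: infinite_finite_induct) (simp_all add: twisted_mult_add_right)

lemma twisted_mult_single:
  "twisted_mult \<mu> c (Poly_Mapping.single s a) (Poly_Mapping.single t b) =
     Poly_Mapping.single (\<mu> s t) (a * b * c s t)"
  by (simp add: twisted_mult_def)

lemma poly_mapping_sum_single:
  "x = (\<Sum>s\<in>Poly_Mapping.keys x. Poly_Mapping.single s (Poly_Mapping.lookup x s))"
  by (rule poly_mapping_eqI) (simp add: lookup_sum lookup_single when_def in_keys_iff)

text \<open>Both sides are expanded over triples of basis vectors. Associativity of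
  \<open>\<mu>\<close> is asked for only where the scalar is nonzero; elsewhere the cocycle identity
  makes both terms zero, whatever the basis vectors are.\<close>

lemma twisted_mult_assoc:
  assumes cocycle: "\<And>s t u. \<lbrakk>s \<in> B; t \<in> B; u \<in> B\<rbrakk> \<Longrightarrow> c s t * c (\<mu> s t) u = c t u * c s (\<mu> t u)"
    and assoc: "\<And>s t u. \<lbrakk>s \<in> B; t \<in> B; u \<in> B; c s t * c (\<mu> s t) u \<noteq> 0\<rbrakk> \<Longrightarrow> \<mu> (\<mu> s t) u = \<mu> s (\<mu> t u)"
    and B: "Poly_Mapping.keys x \<subseteq> B" "Poly_Mapping.keys y \<subseteq> B" "Poly_Mapping.keys z \<subseteq> B"
  shows "twisted_mult \<mu> c (twisted_mult \<mu> c x y) z = twisted_mult \<mu> c x (twisted_mult \<mu> c y z)"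
proof -
  let ?X = "Poly_Mapping.keys x" and ?Y = "Poly_Mapping.keys y" and ?Z = "Poly_Mapping.keys z"
  let ?x = "Poly_Mapping.lookup x" and ?y = "Poly_Mapping.lookup y" and ?z = "Poly_Mapping.lookup z"
  have "twisted_mult \<mu> c (twisted_mult \<mu> c x y) z = (\<Sum>s\<in>?X. \<Sum>t\<in>?Y. \<Sum>u\<in>?Z.
      Poly_Mapping.single (\<mu> (\<mu> s t) u) (?x s * ?y t * c s t * ?z u * c (\<mu> s t) u))"
    by (subst poly_mapping_sum_single[of z], subst twisted_mult_def[of _ _ x],
        simp only: twisted_mult_sum_left, simp only: twisted_mult_sum_right twisted_mult_single)
  also have "\<dots> = (\<Sum>s\<in>?X. \<Sum>t\<in>?Y. \<Sum>u\<in>?Z.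
      Poly_Mapping.single (\<mu> s (\<mu> t u)) (?x s * (?y t * ?z u * c t u) * c s (\<mu> t u)))"
  proof (intro sum.cong refl)
    fix s t u assume "s \<in> ?X" "t \<in> ?Y" "u \<in> ?Z"
    then have stu: "s \<in> B" "t \<in> B" "u \<in> B" using B by auto
    have 1: "?x s * ?y t * c s t * ?z u * c (\<mu> s t) u = ?x s * ?y t * ?z u * (c s t * c (\<mu> s t) u)"
      by (simp add: ac_simps)
    have 2: "?x s * (?y t * ?z u * c t u) * c s (\<mu> t u) = ?x s * ?y t * ?z u * (c t u * c s (\<mu> t u))"
      by (simp add: ac_simps)
    show "Poly_Mapping.single (\<mu> (\<mu> s t) u) (?x s * ?y t * c s t * ?z u * c (\<mu> s t) u) =
        Poly_Mapping.single (\<mu> s (\<mu> t u)) (?x s * (?y t * ?z u * c t u) * c s (\<mu> t u))"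
      unfolding 1 2 cocycle[OF stu, symmetric]
      using assoc[OF stu] by (cases "c s t * c (\<mu> s t) u = 0") simp_all
  qed
  also have "\<dots> = twisted_mult \<mu> c x (twisted_mult \<mu> c y z)"
  proof (rule sym)
    show "twisted_mult \<mu> c x (twisted_mult \<mu> c y z) = (\<Sum>s\<in>?X. \<Sum>t\<in>?Y. \<Sum>u\<in>?Z.
      Poly_Mapping.single (\<mu> s (\<mu> t u)) (?x s * (?y t * ?z u * c t u) * c s (\<mu> t u)))"
      by (subst poly_mapping_sum_single[of x], subst twisted_mult_def[of _ _ y],
          simp only: twisted_mult_sum_left, simp only: twisted_mult_sum_right twisted_mult_single)
  qed
  finally show ?thesis .
qed

text \<open>Terms with zero coefficient contribute no key, so closure of \<open>B\<close> has to be
  checked only for products that do not vanish.\<close>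

lemma keys_twisted_mult:
  assumes "\<And>s t. \<lbrakk>s \<in> Poly_Mapping.keys x; t \<in> Poly_Mapping.keys y; c s t \<noteq> 0\<rbrakk> \<Longrightarrow> \<mu> s t \<in> B"
  shows "Poly_Mapping.keys (twisted_mult \<mu> c x y) \<subseteq> B"
proof -
  have "Poly_Mapping.keys (Poly_Mapping.single (\<mu> s t) (Poly_Mapping.lookup x s * Poly_Mapping.lookup y t * c s t)) \<subseteq> B"
    if "s \<in> Poly_Mapping.keys x" "t \<in> Poly_Mapping.keys y" for s t
    using assms[OF that] by (cases "c s t = 0") auto
  then show ?thesis
    unfolding twisted_mult_def by (intro order_trans[OF keys_sum] UN_least)
qed

end

section \<open>The subcharacter product as a twisted product\<close>

text \<open>A total operation: for incompatible arguments the character component may depend on a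
  choice, but \<open>subchar_coeff\<close> is zero there.\<close>

definition star_subchar ::
  "('g, 'x) monoid_scheme \<Rightarrow> ('a, 'y) monoid_scheme \<Rightarrow> ('g, 'a) subchar \<Rightarrow> ('g, 'a) subchar \<Rightarrow> ('g, 'a) subchar" where
  "star_subchar G A s t = (star_prod G (fst s) (fst t), star_char G A s t)"

definition subchar_coeff ::
  "('g, 'x) monoid_scheme \<Rightarrow> ('a, 'y) monoid_scheme \<Rightarrow> (nat \<Rightarrow> 'k::field) \<Rightarrow> ('g, 'a) subchar \<Rightarrow> ('g, 'a) subchar \<Rightarrow> 'k" where
  "subchar_coeff G A l s t =
     (if compatible G A s t then l (card (k2 G (fst s) \<inter> k1 G (fst t))) else 0)"

lemma subchar_mult_eq_twisted_mult:
  "subchar_mult G A l = twisted_mult (star_subchar G A) (subchar_coeff G A l)"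
  by (intro ext) (auto simp: subchar_mult_def twisted_mult_def star_subchar_def subchar_coeff_def intro!: sum.cong)

text \<open>The order of a subgroup of a direct product is the order of its first projection times
  that of the kernel. Indeed, for \<open>(a, b) \<in> X\<close>, left multiplication by
  \<open>b\<close> carries the fibre over \<open>\<one>\<close> onto the fibre over
  \<open>a\<close>.\<close>

lemma (in group) card_relation_fst:
  assumes X: "finite X" "X \<subseteq> carrier G \<times> carrier G"
    and mult: "\<And>a b c d. \<lbrakk>(a, b) \<in> X; (c, d) \<in> X\<rbrakk> \<Longrightarrow> (a \<otimes> c, b \<otimes> d) \<in> X"
    and inv: "\<And>a b. (a, b) \<in> X \<Longrightarrow> (inv a, inv b) \<in> X"
  shows "card X = card (fst ` X) * card {b. (\<one>, b) \<in> X}"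
proof -
  have fiber: "card {b. (a, b) \<in> X} = card {b. (\<one>, b) \<in> X}" if ab: "(a, b) \<in> X" for a b
  proof -
    have a: "a \<in> carrier G" and b: "b \<in> carrier G" using X ab by auto
    have "bij_betw (\<lambda>d. b \<otimes> d) {d. (\<one>, d) \<in> X} {d. (a, d) \<in> X}"
    proof (rule bij_betw_byWitness[where f' = "\<lambda>d. inv b \<otimes> d"])
      show "\<forall>d\<in>{d. (\<one>, d) \<in> X}. inv b \<otimes> (b \<otimes> d) = d" "\<forall>d\<in>{d. (a, d) \<in> X}. b \<otimes> (inv b \<otimes> d) = d"
        using X b by (auto simp: m_assoc[symmetric])
      show "(\<lambda>d. b \<otimes> d) ` {d. (\<one>, d) \<in> X} \<subseteq> {d. (a, d) \<in> X}"
        using mult[OF ab] a by fastforce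
      show "(\<lambda>d. inv b \<otimes> d) ` {d. (a, d) \<in> X} \<subseteq> {d. (\<one>, d) \<in> X}"
        using mult[OF inv[OF ab]] a by fastforce
    qed
    then show ?thesis by (metis bij_betw_same_card)
  qed
  have X_eq: "X = (SIGMA a:fst ` X. {b. (a, b) \<in> X})" by force
  have fin: "finite {b. (a, b) \<in> X}" for a
    by (rule finite_subset[of _ "snd ` X"]) (use X in force)+
  have "card X = (\<Sum>a\<in>fst ` X. card {b. (a, b) \<in> X})"
    by (subst X_eq, rule card_SigmaI) (use X fin in auto)
  also have "\<dots> = (\<Sum>a\<in>fst ` X. card {b. (\<one>, b) \<in> X})"
    by (rule sum.cong) (use fiber in auto)
  finally show ?thesis by simp
qed

section \<open>Composition of subcharacters: closure, associativity and unit\<close>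

locale subchar_groups = G?: group G + A: comm_group A
  for G :: "('g, 'x) monoid_scheme" (structure) and A :: "('a, 'y) monoid_scheme" +
  assumes finite_carrier: "finite (carrier G)"
begin

text \<open>The conditions are spelled out in coordinates so that later arguments can treat
  subgroups as relations on \<open>G\<close>.\<close>

lemma subgroup_DirProd_iff:
  "subgroup U (G \<times>\<times> G) \<longleftrightarrow> U \<subseteq> carrier G \<times> carrier G \<and> (\<one>, \<one>) \<in> U \<and>
     (\<forall>a b c d. (a, b) \<in> U \<longrightarrow> (c, d) \<in> U \<longrightarrow> (a \<otimes> c, b \<otimes> d) \<in> U) \<and>
     (\<forall>a b. (a, b) \<in> U \<longrightarrow> (inv a, inv b) \<in> U)"
proof -
  have inv: "inv\<^bsub>G \<times>\<times> G\<^esub> (a, b) = (inv a, inv b)" if "a \<in> carrier G" "b \<in> carrier G" for a b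
    using that G.is_group by (simp add: inv_DirProd)
  show ?thesis
  proof
    assume U: "subgroup U (G \<times>\<times> G)"
    have sub: "U \<subseteq> carrier G \<times> carrier G" using subgroup.subset[OF U] by simp
    moreover have "(\<one>, \<one>) \<in> U" using subgroup.one_closed[OF U] by simp
    moreover have "(a \<otimes> c, b \<otimes> d) \<in> U" if "(a, b) \<in> U" "(c, d) \<in> U" for a b c d
      using subgroup.m_closed[OF U that] by simp
    moreover have "(inv a, inv b) \<in> U" if "(a, b) \<in> U" for a b
      using subgroup.m_inv_closed[OF U that] inv[of a b] sub that by auto
    ultimately show "U \<subseteq> carrier G \<times> carrier G \<and> (\<one>, \<one>) \<in> U \<and>
     (\<forall>a b c d. (a, b) \<in> U \<longrightarrow> (c, d) \<in> U \<longrightarrow> (a \<otimes> c, b \<otimes> d) \<in> U) \<and>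
     (\<forall>a b. (a, b) \<in> U \<longrightarrow> (inv a, inv b) \<in> U)" by blast
  next
    assume *: "U \<subseteq> carrier G \<times> carrier G \<and> (\<one>, \<one>) \<in> U \<and>
     (\<forall>a b c d. (a, b) \<in> U \<longrightarrow> (c, d) \<in> U \<longrightarrow> (a \<otimes> c, b \<otimes> d) \<in> U) \<and>
     (\<forall>a b. (a, b) \<in> U \<longrightarrow> (inv a, inv b) \<in> U)"
    show "subgroup U (G \<times>\<times> G)"
      by (rule subgroup.intro) (use * inv in \<open>auto simp: subset_iff\<close>)
  qed
qed

lemma subcharacters_iff:
  "(U, \<phi>) \<in> subcharacters G A \<longleftrightarrow> subgroup U (G \<times>\<times> G) \<and> \<phi> \<in> extensional U \<and>
     (\<forall>a b. (a, b) \<in> U \<longrightarrow> \<phi> (a, b) \<in> carrier A) \<and>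
     (\<forall>a b c d. (a, b) \<in> U \<longrightarrow> (c, d) \<in> U \<longrightarrow> \<phi> (a \<otimes> c, b \<otimes> d) = \<phi> (a, b) \<otimes>\<^bsub>A\<^esub> \<phi> (c, d))"
  unfolding subcharacters_def characters_def hom_def Pi_def by (auto; force)

context
  fixes U \<phi> assumes U\<phi>: "(U, \<phi>) \<in> subcharacters G A"
begin

lemma subchar_subgroup: "subgroup U (G \<times>\<times> G)"
  using U\<phi> by (simp add: subcharacters_iff)

lemma subchar_in_carrier: "(a, b) \<in> U \<Longrightarrow> a \<in> carrier G" "(a, b) \<in> U \<Longrightarrow> b \<in> carrier G"
  and subchar_one_closed: "(\<one>, \<one>) \<in> U"
  and subchar_mult_closed: "\<lbrakk>(a, b) \<in> U; (c, d) \<in> U\<rbrakk> \<Longrightarrow> (a \<otimes> c, b \<otimes> d) \<in> U"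
  and subchar_inv_closed: "(a, b) \<in> U \<Longrightarrow> (inv a, inv b) \<in> U"
  using subchar_subgroup unfolding subgroup_DirProd_iff by blast+

lemma subchar_value_closed: "(a, b) \<in> U \<Longrightarrow> \<phi> (a, b) \<in> carrier A"
  and subchar_value_mult: "\<lbrakk>(a, b) \<in> U; (c, d) \<in> U\<rbrakk> \<Longrightarrow> \<phi> (a \<otimes> c, b \<otimes> d) = \<phi> (a, b) \<otimes>\<^bsub>A\<^esub> \<phi> (c, d)"
  and subchar_extensional: "\<phi> \<in> extensional U"
  using U\<phi> by (simp_all add: subcharacters_iff)

lemma subchar_value_one: "\<phi> (\<one>, \<one>) = \<one>\<^bsub>A\<^esub>"
  using subchar_value_mult[of \<one> \<one> \<one> \<one>] subchar_value_closed[of \<one> \<one>] subchar_one_closed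
  by (simp add: A.l_cancel_one')

end

lemmas subchar_closed =
  subchar_in_carrier subchar_one_closed subchar_mult_closed subchar_inv_closed subchar_value_closed

lemma subgroup_star_prod:
  assumes U: "subgroup U (G \<times>\<times> G)" and V: "subgroup V (G \<times>\<times> G)"
  shows "subgroup (star_prod G U V) (G \<times>\<times> G)"
proof -
  note U' = U[unfolded subgroup_DirProd_iff] and V' = V[unfolded subgroup_DirProd_iff]
  have "star_prod G U V \<subseteq> carrier G \<times> carrier G"
    using U' V' by (auto simp: star_prod_def)
  moreover have "(\<one>, \<one>) \<in> star_prod G U V"
    using U' V' by (auto simp: star_prod_def)
  moreover have "(a \<otimes> c, b \<otimes> d) \<in> star_prod G U V"
    if "(a, b) \<in> star_prod G U V" "(c, d) \<in> star_prod G U V" for a b c d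
    using that U' V' unfolding star_prod_def by clarsimp (metis m_closed)
  moreover have "(inv a, inv b) \<in> star_prod G U V" if "(a, b) \<in> star_prod G U V" for a b
    using that U' V' unfolding star_prod_def by clarsimp (metis inv_closed)
  ultimately show ?thesis unfolding subgroup_DirProd_iff by blast
qed

lemma star_prodI: "\<lbrakk>g \<in> carrier G; (u, g) \<in> U; (g, v) \<in> V\<rbrakk> \<Longrightarrow> (u, v) \<in> star_prod G U V"
  by (auto simp: star_prod_def)

lemma star_prodE:
  assumes "(u, v) \<in> star_prod G U V"
  obtains g where "g \<in> carrier G" "(u, g) \<in> U" "(g, v) \<in> V"
  using assms by (auto simp: star_prod_def)

lemma star_char_value:
  assumes "(U, \<phi>) \<in> subcharacters G A" "(V, \<psi>) \<in> subcharacters G A" "compatible G A (U, \<phi>) (V, \<psi>)"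
    and "(u, g) \<in> U" "(g, v) \<in> V"
  shows "star_char G A (U, \<phi>) (V, \<psi>) (u, v) = \<phi> (u, g) \<otimes>\<^bsub>A\<^esub> \<psi> (g, v)"
  using star_char_eq[OF G.is_group A.comm_group_axioms] assms subchar_in_carrier by blast

lemma star_char_extensional: "star_char G A (U, \<phi>) (V, \<psi>) \<in> extensional (star_prod G U V)"
  by (simp add: star_char_def)

text \<open>Middle elements \<open>g\<close> and \<open>h\<close> for two pairs multiply to a middle
  element for the product of the pairs. Commutativity of \<open>A\<close> then separates the two
  values.\<close>

lemma star_subchar_closed:
  assumes s: "s \<in> subcharacters G A" and t: "t \<in> subcharacters G A" and st: "compatible G A s t"
  shows "star_subchar G A s t \<in> subcharacters G A"
proof -
  obtain U \<phi> V \<psi> where [simp]: "s = (U, \<phi>)" "t = (V, \<psi>)" by (metis surj_pair)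
  note s' = s[simplified] and t' = t[simplified] and st' = st[simplified]
  note val = star_char_value[OF s' t' st']
  let ?\<chi> = "star_char G A (U, \<phi>) (V, \<psi>)"
  have "?\<chi> (a, b) \<in> carrier A" if "(a, b) \<in> star_prod G U V" for a b
    using that by (elim star_prodE) (simp add: val subchar_value_closed[OF s'] subchar_value_closed[OF t'])
  moreover have "?\<chi> (a \<otimes> c, b \<otimes> d) = ?\<chi> (a, b) \<otimes>\<^bsub>A\<^esub> ?\<chi> (c, d)"
    if ab: "(a, b) \<in> star_prod G U V" and cd: "(c, d) \<in> star_prod G U V" for a b c d
  proof -
    obtain g where g: "(a, g) \<in> U" "(g, b) \<in> V" using ab by (rule star_prodE)
    obtain h where h: "(c, h) \<in> U" "(h, d) \<in> V" using cd by (rule star_prodE)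
    have "?\<chi> (a \<otimes> c, b \<otimes> d) = \<phi> (a \<otimes> c, g \<otimes> h) \<otimes>\<^bsub>A\<^esub> \<psi> (g \<otimes> h, b \<otimes> d)"
      using subchar_mult_closed[OF s'] subchar_mult_closed[OF t'] g h by (intro val) auto
    then show ?thesis
      using g h by (simp add: val[OF g] val[OF h] subchar_value_mult[OF s'] subchar_value_mult[OF t']
          subchar_value_closed[OF s'] subchar_value_closed[OF t'] A.m_ac)
  qed
  ultimately show ?thesis
    using subgroup_star_prod[OF subchar_subgroup[OF s'] subchar_subgroup[OF t']]
    by (simp add: star_subchar_def subcharacters_iff star_char_extensional)
qed

text \<open>Both sides amount to \<phi>(1,g) \<psi>(g,h) \<chi>(h,1) = 1 for all g, h with (1,g) in
  \<open>U\<close>, (g,h) in \<open>V\<close> and (h,1) in \<open>W\<close>. The inner compatibility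
  is always established first, since only then does \<open>star_char\<close> have its expected
  values.\<close>

lemma compatible_assoc:
  assumes s: "s \<in> subcharacters G A" and t: "t \<in> subcharacters G A" and u: "u \<in> subcharacters G A"
  shows "compatible G A s t \<and> compatible G A (star_subchar G A s t) u \<longleftrightarrow>
    compatible G A t u \<and> compatible G A s (star_subchar G A t u)"
proof -
  obtain U \<phi> V \<psi> W \<chi> where [simp]: "s = (U, \<phi>)" "t = (V, \<psi>)" "u = (W, \<chi>)" by (metis surj_pair)
  note s' = s[simplified] and t' = t[simplified] and u' = u[simplified]
  note closed = subchar_value_closed[OF s'] subchar_value_closed[OF t'] subchar_value_closed[OF u']
  note one = subchar_one_closed[OF s'] subchar_one_closed[OF t'] subchar_one_closed[OF u']
    subchar_value_one[OF s'] subchar_value_one[OF t'] subchar_value_one[OF u']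
  note carrier = subchar_in_carrier[OF s'] subchar_in_carrier[OF t'] subchar_in_carrier[OF u']
  show ?thesis
  proof (intro iffI conjI; elim conjE)
    assume st: "compatible G A s t" and stu: "compatible G A (star_subchar G A s t) u"
    note val = star_char_value[OF s' t' st[simplified]]
    have eq: "\<phi> (\<one>, g) \<otimes>\<^bsub>A\<^esub> \<psi> (g, h) \<otimes>\<^bsub>A\<^esub> \<chi> (h, \<one>) = \<one>\<^bsub>A\<^esub>"
      if "(\<one>, g) \<in> U" "(g, h) \<in> V" "(h, \<one>) \<in> W" for g h
    proof -
      have "h \<in> k2 G (star_prod G U V) \<inter> k1 G W"
        using carrier that by (auto simp: k1_def k2_def intro: star_prodI[of g] star_prodI[of h])
      then have "star_char G A (U, \<phi>) (V, \<psi>) (\<one>, h) \<otimes>\<^bsub>A\<^esub> \<chi> (h, \<one>) = \<one>\<^bsub>A\<^esub>"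
        using stu by (auto simp: star_subchar_def compatible_def)
      then show ?thesis
        using val[OF that(1,2)] by simp
    qed
    \<comment> \<open>The case in which the first middle element is \<open>\<one>\<close>, where
      \<phi> contributes 1.\<close>
    show tu: "compatible G A t u"
      using eq[of \<one>] one closed unfolding compatible_def k1_def k2_def by auto
    note val' = star_char_value[OF t' u' tu[simplified]]
    show "compatible G A s (star_subchar G A t u)"
      using eq val' closed unfolding star_subchar_def compatible_def k1_def k2_def
      by (auto elim!: star_prodE simp: A.m_assoc)
  next
    assume tu: "compatible G A t u" and stu: "compatible G A s (star_subchar G A t u)"
    note val = star_char_value[OF t' u' tu[simplified]]
    have eq: "\<phi> (\<one>, g) \<otimes>\<^bsub>A\<^esub> (\<psi> (g, h) \<otimes>\<^bsub>A\<^esub> \<chi> (h, \<one>)) = \<one>\<^bsub>A\<^esub>"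
      if "(\<one>, g) \<in> U" "(g, h) \<in> V" "(h, \<one>) \<in> W" for g h
    proof -
      have "g \<in> k2 G U \<inter> k1 G (star_prod G V W)"
        using carrier that by (auto simp: k1_def k2_def intro: star_prodI[of g] star_prodI[of h])
      then have "\<phi> (\<one>, g) \<otimes>\<^bsub>A\<^esub> star_char G A (V, \<psi>) (W, \<chi>) (g, \<one>) = \<one>\<^bsub>A\<^esub>"
        using stu by (auto simp: star_subchar_def compatible_def)
      then show ?thesis
        using val[OF that(2,3)] by simp
    qed
    \<comment> \<open>Symmetrically, the second middle element is taken to be \<open>\<one>\<close>,
      where \<chi> contributes 1.\<close>
    show st: "compatible G A s t"
      using eq[of _ \<one>] one closed unfolding compatible_def k1_def k2_def by auto
    note val' = star_char_value[OF s' t' st[simplified]]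
    show "compatible G A (star_subchar G A s t) u"
      using eq val' closed unfolding star_subchar_def compatible_def k1_def k2_def
      by (auto elim!: star_prodE simp: A.m_assoc)
  qed
qed

lemma star_prod_assoc: "star_prod G (star_prod G U V) W = star_prod G U (star_prod G V W)"
  unfolding star_prod_def by blast

text \<open>For any chain a, g, h, b through the three relations, both characters take the value
  \<phi>(a,g) \<psi>(g,h) \<chi>(h,b) at (a,b).\<close>

lemma star_subchar_assoc:
  assumes s: "s \<in> subcharacters G A" and t: "t \<in> subcharacters G A" and u: "u \<in> subcharacters G A"
    and st: "compatible G A s t" and stu: "compatible G A (star_subchar G A s t) u"
  shows "star_subchar G A (star_subchar G A s t) u = star_subchar G A s (star_subchar G A t u)"
proof -
  obtain U \<phi> V \<psi> W \<chi> where [simp]: "s = (U, \<phi>)" "t = (V, \<psi>)" "u = (W, \<chi>)" by (metis surj_pair)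
  have tu: "compatible G A t u" and s_tu: "compatible G A s (star_subchar G A t u)"
    using compatible_assoc[OF s t u] st stu by auto
  note s' = s[simplified] and t' = t[simplified] and u' = u[simplified]
  note st' = star_subchar_closed[OF s t st, unfolded star_subchar_def, simplified]
  note tu' = star_subchar_closed[OF t u tu, unfolded star_subchar_def, simplified]
  have "star_char G A (star_subchar G A s t) u (a, b) = star_char G A s (star_subchar G A t u) (a, b)"
    if ab: "(a, b) \<in> star_prod G U (star_prod G V W)" for a b
  proof -
    obtain g h where gh: "g \<in> carrier G" "h \<in> carrier G" "(a, g) \<in> U" "(g, h) \<in> V" "(h, b) \<in> W"
      using ab unfolding star_prod_def by blast
    have "star_char G A (star_subchar G A s t) u (a, b) = star_char G A s t (a, h) \<otimes>\<^bsub>A\<^esub> \<chi> (h, b)"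
      using star_char_value[OF st' u' stu[unfolded star_subchar_def, simplified]]
        gh star_prodI[OF gh(1,3,4)]
      by (simp add: star_subchar_def)
    also have "\<dots> = \<phi> (a, g) \<otimes>\<^bsub>A\<^esub> (\<psi> (g, h) \<otimes>\<^bsub>A\<^esub> \<chi> (h, b))"
      using star_char_value[OF s' t' st[simplified]] gh subchar_value_closed[OF s']
        subchar_value_closed[OF t'] subchar_value_closed[OF u'] by (simp add: A.m_assoc)
    also have "\<dots> = \<phi> (a, g) \<otimes>\<^bsub>A\<^esub> star_char G A t u (g, b)"
      using star_char_value[OF t' u' tu[simplified]] gh by simp
    also have "\<dots> = star_char G A s (star_subchar G A t u) (a, b)"
      using star_char_value[OF s' tu' s_tu[unfolded star_subchar_def, simplified]]
        gh star_prodI[OF gh(2,4,5)]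
      by (simp add: star_subchar_def)
    finally show ?thesis .
  qed
  then have "star_char G A (star_subchar G A s t) u = star_char G A s (star_subchar G A t u)"
    by (intro extensionalityI[of _ "star_prod G U (star_prod G V W)"])
      (auto simp: star_subchar_def star_char_extensional
        intro: star_char_extensional[of "star_prod G U V" _ W, unfolded star_prod_assoc])
  then show ?thesis
    by (simp add: star_subchar_def star_prod_assoc)
qed

text \<open>Both sides count the pairs \<open>(g, h)\<close> with \<open>(1, g) \<in> U\<close>, \<open>(g, h) \<in> V\<close> and \<open>(h, 1) \<in> W\<close>,
  fibred over either coordinate.\<close>

lemma card_k2_k1_cocycle:
  assumes U: "subgroup U (G \<times>\<times> G)" and V: "subgroup V (G \<times>\<times> G)" and W: "subgroup W (G \<times>\<times> G)"
  shows "card (k2 G U \<inter> k1 G V) * card (k2 G (star_prod G U V) \<inter> k1 G W) =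
    card (k2 G V \<inter> k1 G W) * card (k2 G U \<inter> k1 G (star_prod G V W))"
proof -
  note U' = U[unfolded subgroup_DirProd_iff] and V' = V[unfolded subgroup_DirProd_iff]
    and W' = W[unfolded subgroup_DirProd_iff]
  define X where "X = {(g, h). (\<one>, g) \<in> U \<and> (g, h) \<in> V \<and> (h, \<one>) \<in> W}"
  have X: "X \<subseteq> carrier G \<times> carrier G" using V' by (auto simp: X_def)
  have fin: "finite X" using X finite_carrier by (meson finite_SigmaI finite_subset)
  have mult: "(a \<otimes> c, b \<otimes> d) \<in> X" if "(a, b) \<in> X" "(c, d) \<in> X" for a b c d
    using that U' V' W' unfolding X_def by clarsimp (metis r_one one_closed)
  have inv: "(inv a, inv b) \<in> X" if "(a, b) \<in> X" for a b
    using that U' V' W' unfolding X_def by clarsimp (metis inv_one)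
  have "card X = card (fst ` X) * card {b. (\<one>, b) \<in> X}"
    by (rule card_relation_fst[OF fin X mult inv])
  also have "fst ` X = k2 G U \<inter> k1 G (star_prod G V W)"
    unfolding Domain_fst[symmetric] X_def k1_def k2_def star_prod_def using V'[THEN conjunct1] by blast
  also have "{b. (\<one>, b) \<in> X} = k2 G V \<inter> k1 G W"
    using V'[THEN conjunct1] U'[THEN conjunct2, THEN conjunct1] by (auto simp: X_def k1_def k2_def)
  finally have 1: "card X = card (k2 G U \<inter> k1 G (star_prod G V W)) * card (k2 G V \<inter> k1 G W)" .
  have "card (X\<inverse>) = card (fst ` (X\<inverse>)) * card {b. (\<one>, b) \<in> X\<inverse>}"
    by (rule card_relation_fst) (use fin X mult inv in auto)
  also have "fst ` (X\<inverse>) = k2 G (star_prod G U V) \<inter> k1 G W"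
    unfolding Domain_fst[symmetric] X_def k1_def k2_def star_prod_def using V'[THEN conjunct1] by blast
  also have "{b. (\<one>, b) \<in> X\<inverse>} = k2 G U \<inter> k1 G V"
    using V'[THEN conjunct1] W'[THEN conjunct2, THEN conjunct1] by (auto simp: X_def k1_def k2_def)
  finally have "card X = card (k2 G (star_prod G U V) \<inter> k1 G W) * card (k2 G U \<inter> k1 G V)"
    by simp
  with 1 show ?thesis by (simp add: mult.commute)
qed


text \<open>Needed because \<ell> is multiplicative only on positive integers.\<close>

lemma card_k2_k1_pos:
  assumes U: "subgroup U (G \<times>\<times> G)" and V: "subgroup V (G \<times>\<times> G)"
  shows "card (k2 G U \<inter> k1 G V) > 0"
proof -
  have "\<one> \<in> k2 G U \<inter> k1 G V"
    using U V by (auto simp: subgroup_DirProd_iff k1_def k2_def)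
  moreover have "finite (k2 G U \<inter> k1 G V)"
    using finite_carrier by (simp add: k1_def)
  ultimately show ?thesis
    using card_gt_0_iff by blast
qed

lemma diag_subchar_closed: "diag_subchar G A \<in> subcharacters G A"
  by (auto simp: diag_subchar_def Let_def subcharacters_iff subgroup_DirProd_iff)

lemma k1_diag: "k1 G (fst (diag_subchar G A)) = {\<one>}"
  and k2_diag: "k2 G (fst (diag_subchar G A)) = {\<one>}"
  by (auto simp: k1_def k2_def diag_subchar_def Let_def)

lemma snd_diag: "g \<in> carrier G \<Longrightarrow> snd (diag_subchar G A) (g, g) = \<one>\<^bsub>A\<^esub>"
  by (auto simp: diag_subchar_def Let_def)

lemma compatible_diag:
  assumes s: "s \<in> subcharacters G A"
  shows "compatible G A (diag_subchar G A) s" "compatible G A s (diag_subchar G A)"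
proof -
  obtain U \<phi> where [simp]: "s = (U, \<phi>)" by (metis surj_pair)
  obtain D \<delta> where D: "diag_subchar G A = (D, \<delta>)" by (metis surj_pair)
  show "compatible G A (diag_subchar G A) s" "compatible G A s (diag_subchar G A)"
    using k1_diag k2_diag snd_diag[of \<one>] subchar_value_one[OF s[simplified]]
    by (auto simp: compatible_def D)
qed

lemma star_subchar_diag:
  assumes s: "s \<in> subcharacters G A"
  shows "star_subchar G A (diag_subchar G A) s = s" "star_subchar G A s (diag_subchar G A) = s"
proof -
  obtain U \<phi> where [simp]: "s = (U, \<phi>)" by (metis surj_pair)
  obtain D \<delta> where D: "diag_subchar G A = (D, \<delta>)" by (metis surj_pair)
  note s' = s[simplified] and d' = diag_subchar_closed[unfolded D]
  note c = compatible_diag[OF s, unfolded D, simplified]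
  have D_eq: "D = {(g, g) | g. g \<in> carrier G}"
    using D by (auto simp: diag_subchar_def Let_def)
  have \<delta>: "g \<in> carrier G \<Longrightarrow> \<delta> (g, g) = \<one>\<^bsub>A\<^esub>" for g
    using snd_diag[of g] D by simp
  have U: "star_prod G D U = U" "star_prod G U D = U"
    using subchar_in_carrier[OF s'] by (auto simp: star_prod_def D_eq)
  have "star_char G A (D, \<delta>) (U, \<phi>) = \<phi>"
    by (rule extensionalityI[of _ U])
      (use star_char_extensional[of D \<delta> U \<phi>] subchar_extensional[OF s'] U star_char_value[OF d' s' c(1)]
        \<delta> subchar_in_carrier[OF s'] subchar_value_closed[OF s'] in \<open>auto simp: D_eq\<close>)
  moreover have "star_char G A (U, \<phi>) (D, \<delta>) = \<phi>"
    by (rule extensionalityI[of _ U])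
      (use star_char_extensional[of U \<phi> D \<delta>] subchar_extensional[OF s'] U star_char_value[OF s' d' c(2)]
        \<delta> subchar_in_carrier[OF s'] subchar_value_closed[OF s'] in \<open>auto simp: D_eq\<close>)
  ultimately show "star_subchar G A (diag_subchar G A) s = s" "star_subchar G A s (diag_subchar G A) = s"
    by (simp_all add: star_subchar_def D U)
qed

section \<open>Pairs of a subgroup and a character, and the basis of the module\<close>

definition char_pairs :: "('g set \<times> ('g \<Rightarrow> 'a)) set" where
  "char_pairs = {(E, \<phi>). subgroup E G \<and> \<phi> \<in> characters G A E}"

text \<open>Parametrises the basis of \<open>S11\<close> by the pairs on which the agreement form
  lives.\<close>

definition left_subchar :: "'g set \<times> ('g \<Rightarrow> 'a) \<Rightarrow> ('g, 'a) subchar" where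
  "left_subchar = (\<lambda>(E, \<phi>). (E \<times> {\<one>}, restrict (\<lambda>(e, _). \<phi> e) (E \<times> {\<one>})))"

lemma left_subcharacters_eq_image: "left_subcharacters G A = left_subchar ` char_pairs"
  by (auto simp: left_subcharacters_def left_subchar_def char_pairs_def image_iff)

lemma char_pairs_iff:
  "(E, \<phi>) \<in> char_pairs \<longleftrightarrow> subgroup E G \<and> \<phi> \<in> extensional E \<and> (\<forall>a\<in>E. \<phi> a \<in> carrier A) \<and>
     (\<forall>a\<in>E. \<forall>b\<in>E. \<phi> (a \<otimes> b) = \<phi> a \<otimes>\<^bsub>A\<^esub> \<phi> b)"
  by (auto simp: char_pairs_def characters_def hom_def)

lemma char_pairs_one:
  assumes "(E, \<phi>) \<in> char_pairs"
  shows "\<one> \<in> E" "\<phi> \<one> = \<one>\<^bsub>A\<^esub>"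
proof -
  show 1: "\<one> \<in> E"
    using assms by (auto simp: char_pairs_iff intro: subgroup.one_closed)
  then have "\<phi> (\<one> \<otimes> \<one>) = \<phi> \<one> \<otimes>\<^bsub>A\<^esub> \<phi> \<one>" "\<phi> \<one> \<in> carrier A"
    using assms unfolding char_pairs_iff by blast+
  then show "\<phi> \<one> = \<one>\<^bsub>A\<^esub>"
    by (simp add: A.l_cancel_one')
qed

lemma inj_on_left_subchar: "inj_on left_subchar char_pairs"
proof (rule inj_onI, clarify)
  fix E \<phi> F \<psi>
  assume E: "(E, \<phi>) \<in> char_pairs" and F: "(F, \<psi>) \<in> char_pairs"
    and eq: "left_subchar (E, \<phi>) = left_subchar (F, \<psi>)"
  have EF: "E = F"
    using eq by (auto simp: left_subchar_def)
  moreover have "\<phi> e = \<psi> e" if "e \<in> E" for e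
    using fun_cong[OF arg_cong[OF eq, of snd], of "(e, \<one>)"] that EF by (simp add: left_subchar_def)
  ultimately show "E = F \<and> \<phi> = \<psi>"
    using E F extensionalityI[of \<phi> E \<psi>] by (auto simp: char_pairs_iff)
qed

text \<open>This intrinsic description makes stability under left multiplication immediate:
  composing on the left creates no new second coordinates. Conversely, a subgroup inside
  \<open>carrier G \<times> {\<one>}\<close> is \<open>E \<times> {\<one>}\<close> for its set
  \<open>E\<close> of first coordinates.\<close>

lemma left_subcharacters_iff:
  "(U, \<phi>) \<in> left_subcharacters G A \<longleftrightarrow>
     (U, \<phi>) \<in> subcharacters G A \<and> U \<subseteq> carrier G \<times> {\<one>}"
proof
  assume "(U, \<phi>) \<in> left_subcharacters G A"
  then obtain E \<psi> where E: "(E, \<psi>) \<in> char_pairs" and U: "U = E \<times> {\<one>}"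
    and \<phi>: "\<phi> = restrict (\<lambda>(e, _). \<psi> e) (E \<times> {\<one>})"
    by (auto simp: left_subcharacters_eq_image left_subchar_def)
  have sub: "subgroup E G"
    using E by (simp add: char_pairs_iff)
  show "(U, \<phi>) \<in> subcharacters G A \<and> U \<subseteq> carrier G \<times> {\<one>}"
    using E subgroup.subset[OF sub] subgroup.one_closed[OF sub] subgroup.m_closed[OF sub]
      subgroup.m_inv_closed[OF sub]
    by (auto simp: U \<phi> subcharacters_iff subgroup_DirProd_iff char_pairs_iff)
next
  assume *: "(U, \<phi>) \<in> subcharacters G A \<and> U \<subseteq> carrier G \<times> {\<one>}"
  then have U\<phi>: "(U, \<phi>) \<in> subcharacters G A" and sub: "U \<subseteq> carrier G \<times> {\<one>}"
    by auto
  define E where "E = {e. (e, \<one>) \<in> U}"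
  define \<psi> where "\<psi> = restrict (\<lambda>e. \<phi> (e, \<one>)) E"
  have U: "U = E \<times> {\<one>}"
    using sub by (auto simp: E_def)
  have mult: "a \<otimes> b \<in> E" if "a \<in> E" "b \<in> E" for a b
    using subchar_mult_closed[OF U\<phi>, of a \<one> b \<one>] that by (simp add: E_def)
  have "subgroup E G"
    by (rule subgroup.intro)
      (use sub mult subchar_one_closed[OF U\<phi>] subchar_inv_closed[OF U\<phi>, of _ \<one>] in \<open>auto simp: E_def\<close>)
  moreover have "\<psi> (a \<otimes> b) = \<psi> a \<otimes>\<^bsub>A\<^esub> \<psi> b" if "a \<in> E" "b \<in> E" for a b
    using subchar_value_mult[OF U\<phi>, of a \<one> b \<one>] that mult[OF that] by (simp add: \<psi>_def) (simp add: E_def)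
  ultimately have "(E, \<psi>) \<in> char_pairs"
    using subchar_value_closed[OF U\<phi>, of _ \<one>] by (auto simp: char_pairs_iff \<psi>_def E_def)
  moreover have "\<phi> = restrict (\<lambda>(e, _). \<psi> e) (E \<times> {\<one>})"
    by (rule extensionalityI[of _ U])
      (use subchar_extensional[OF U\<phi>] in \<open>auto simp: U \<psi>_def restrict_extensional\<close>)
  then have "left_subchar (E, \<psi>) = (U, \<phi>)"
    by (simp add: left_subchar_def U)
  ultimately show "(U, \<phi>) \<in> left_subcharacters G A"
    unfolding left_subcharacters_eq_image by (metis image_eqI)
qed

lemma left_subcharacters_subset: "left_subcharacters G A \<subseteq> subcharacters G A"
  using left_subcharacters_iff by auto

lemma star_subchar_left_closed:
  assumes s: "s \<in> subcharacters G A" and t: "t \<in> left_subcharacters G A" and st: "compatible G A s t"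
  shows "star_subchar G A s t \<in> left_subcharacters G A"
proof -
  obtain U \<phi> V \<psi> where [simp]: "s = (U, \<phi>)" "t = (V, \<psi>)" by (metis surj_pair)
  have "star_prod G U V \<subseteq> carrier G \<times> {\<one>}"
    using subchar_in_carrier[of U \<phi>] s t by (auto simp: star_prod_def left_subcharacters_iff)
  then show ?thesis
    using star_subchar_closed[OF s _ st] t left_subcharacters_iff left_subcharacters_subset
    by (auto simp: star_subchar_def)
qed

section \<open>Action of product subcharacters on the module basis\<close>

text \<open>The second character is inverted so that compatibility with \<open>left_subchar\<close>
  becomes equality of characters on the intersection.\<close>

definition product_subchar :: "'g set \<times> ('g \<Rightarrow> 'a) \<Rightarrow> 'g set \<times> ('g \<Rightarrow> 'a) \<Rightarrow> ('g, 'a) subchar" where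
  "product_subchar = (\<lambda>(E, \<alpha>) (F, \<beta>).
     (E \<times> F, restrict (\<lambda>(e, f). \<alpha> e \<otimes>\<^bsub>A\<^esub> inv\<^bsub>A\<^esub> \<beta> f) (E \<times> F)))"

lemma product_subchar_closed:
  assumes r: "r \<in> char_pairs" and s: "s \<in> char_pairs"
  shows "product_subchar r s \<in> subcharacters G A"
proof -
  obtain E \<alpha> F \<beta> where [simp]: "r = (E, \<alpha>)" "s = (F, \<beta>)" by (metis surj_pair)
  have E: "subgroup E G" and F: "subgroup F G"
    using r s by (auto simp: char_pairs_iff)
  have "\<alpha> (a \<otimes> c) \<otimes>\<^bsub>A\<^esub> inv\<^bsub>A\<^esub> \<beta> (b \<otimes> d) =
      (\<alpha> a \<otimes>\<^bsub>A\<^esub> inv\<^bsub>A\<^esub> \<beta> b) \<otimes>\<^bsub>A\<^esub> (\<alpha> c \<otimes>\<^bsub>A\<^esub> inv\<^bsub>A\<^esub> \<beta> d)"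
    if "a \<in> E" "c \<in> E" "b \<in> F" "d \<in> F" for a b c d
    using that r s by (simp add: char_pairs_iff A.inv_mult A.m_ac)
  then show ?thesis
    using r s subgroup.subset[OF E] subgroup.subset[OF F] subgroup.one_closed[OF E] subgroup.one_closed[OF F]
      subgroup.m_closed[OF E] subgroup.m_closed[OF F] subgroup.m_inv_closed[OF E] subgroup.m_inv_closed[OF F]
    by (auto simp: product_subchar_def subcharacters_iff subgroup_DirProd_iff char_pairs_iff)
qed

lemma k_product_subchar_left_subchar:
  assumes r: "r \<in> char_pairs" and s: "s \<in> char_pairs" and t: "t \<in> char_pairs"
  shows "k2 G (fst (product_subchar r s)) \<inter> k1 G (fst (left_subchar t)) = fst s \<inter> fst t"
proof -
  obtain E \<alpha> F \<beta> H \<psi> where [simp]: "r = (E, \<alpha>)" "s = (F, \<beta>)" "t = (H, \<psi>)" by (metis surj_pair)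
  have "F \<subseteq> carrier G"
    using s by (auto simp: char_pairs_iff dest: subgroup.subset)
  then show ?thesis
    using char_pairs_one(1)[of E \<alpha>] r
    by (auto simp: product_subchar_def left_subchar_def k1_def k2_def)
qed

text \<open>Since \<alpha> is 1 at \<open>\<one>\<close>, the condition at g reads \<beta>(g)^{-1}
  \<psi>(g) = 1.\<close>

lemma compatible_product_subchar_left_subchar:
  assumes r: "r \<in> char_pairs" and s: "s \<in> char_pairs" and t: "t \<in> char_pairs"
  shows "compatible G A (product_subchar r s) (left_subchar t) \<longleftrightarrow> (\<forall>g\<in>fst s \<inter> fst t. snd s g = snd t g)"
proof -
  obtain E \<alpha> F \<beta> H \<psi> where [simp]: "r = (E, \<alpha>)" "s = (F, \<beta>)" "t = (H, \<psi>)" by (metis surj_pair)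
  have "compatible G A (product_subchar r s) (left_subchar t) \<longleftrightarrow>
      (\<forall>g\<in>F \<inter> H. snd (product_subchar r s) (\<one>, g) \<otimes>\<^bsub>A\<^esub> snd (left_subchar t) (g, \<one>) = \<one>\<^bsub>A\<^esub>)"
    using k_product_subchar_left_subchar[OF r s t] by (simp add: compatible_def split_beta)
  also have "\<dots> \<longleftrightarrow> (\<forall>g\<in>F \<inter> H. \<beta> g = \<psi> g)"
  proof (rule ball_cong[OF refl])
    fix g assume g: "g \<in> F \<inter> H"
    then have c: "\<beta> g \<in> carrier A" "\<psi> g \<in> carrier A"
      using s t by (auto simp: char_pairs_iff)
    have "snd (product_subchar r s) (\<one>, g) \<otimes>\<^bsub>A\<^esub> snd (left_subchar t) (g, \<one>) = inv\<^bsub>A\<^esub> \<beta> g \<otimes>\<^bsub>A\<^esub> \<psi> g"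
      using char_pairs_one[of E \<alpha>] r g c by (simp add: product_subchar_def left_subchar_def)
    also have "\<dots> = \<one>\<^bsub>A\<^esub> \<longleftrightarrow> \<beta> g = \<psi> g"
      using c by (metis A.inv_closed A.inv_equality A.inv_inv A.l_inv A.m_comm)
    finally show "snd (product_subchar r s) (\<one>, g) \<otimes>\<^bsub>A\<^esub> snd (left_subchar t) (g, \<one>) = \<one>\<^bsub>A\<^esub> \<longleftrightarrow> \<beta> g = \<psi> g" .
  qed
  finally show ?thesis by simp
qed

lemma subchar_coeff_product_subchar:
  assumes "r \<in> char_pairs" "s \<in> char_pairs" "t \<in> char_pairs"
  shows "subchar_coeff G A l (product_subchar r s) (left_subchar t) = agreement_form l s t"
  using assms
  by (simp add: subchar_coeff_def agreement_form_def compatible_product_subchar_left_subchar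
      k_product_subchar_left_subchar)

text \<open>The middle element can always be chosen as \<open>\<one>\<close>, which lies in both F
  and H. There \<beta> and \<psi> are 1, so only \<alpha> remains.\<close>

lemma star_product_subchar_left_subchar:
  assumes r: "r \<in> char_pairs" and s: "s \<in> char_pairs" and t: "t \<in> char_pairs"
    and c: "compatible G A (product_subchar r s) (left_subchar t)"
  shows "star_subchar G A (product_subchar r s) (left_subchar t) = left_subchar r"
proof -
  obtain E \<alpha> F \<beta> H \<psi> where [simp]: "r = (E, \<alpha>)" "s = (F, \<beta>)" "t = (H, \<psi>)" by (metis surj_pair)
  obtain U \<mu> where U: "product_subchar r s = (U, \<mu>)" by (metis surj_pair)
  obtain V \<nu> where V: "left_subchar t = (V, \<nu>)" by (metis surj_pair)
  note one = char_pairs_one[OF r[simplified]] char_pairs_one[OF s[simplified]] char_pairs_one[OF t[simplified]]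
  have UV: "U = E \<times> F" "V = H \<times> {\<one>}"
    using U V by (auto simp: product_subchar_def left_subchar_def)
  have star: "star_prod G U V = E \<times> {\<one>}"
    using one by (auto simp: star_prod_def UV)
  have "(V, \<nu>) \<in> subcharacters G A"
    using t V left_subcharacters_subset left_subcharacters_eq_image by (metis image_eqI subsetD)
  then have "star_char G A (U, \<mu>) (V, \<nu>) (e, \<one>) = \<mu> (e, \<one>) \<otimes>\<^bsub>A\<^esub> \<nu> (\<one>, \<one>)" if "e \<in> E" for e
    using product_subchar_closed[OF r s] c one that
    by (intro star_char_value) (auto simp: UV U[simplified] V[simplified])
  moreover have "\<mu> (e, \<one>) \<otimes>\<^bsub>A\<^esub> \<nu> (\<one>, \<one>) = \<alpha> e" if "e \<in> E" for e
    using U V one that r by (auto simp: product_subchar_def left_subchar_def char_pairs_iff)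
  ultimately have "star_char G A (U, \<mu>) (V, \<nu>) = restrict (\<lambda>(e, _). \<alpha> e) (E \<times> {\<one>})"
    using star_char_extensional[of U \<mu> V \<nu>]
    by (intro extensionalityI[of _ "E \<times> {\<one>}"]) (auto simp: star)
  then show ?thesis
    unfolding star_subchar_def U V by (simp add: star left_subchar_def)
qed

end

section \<open>The deformed algebra and its left module\<close>

locale deformed_subchar_algebra = subchar_groups G A
  for G :: "('g, 'x) monoid_scheme" (structure) and A :: "('a, 'y) monoid_scheme" +
  fixes l :: "nat \<Rightarrow> 'k::field"
  assumes l: "pos_monoid_hom l"
begin

abbreviation mult (infixl \<open>\<star>\<close> 70) where
  "x \<star> y \<equiv> twisted_mult (star_subchar G A) (subchar_coeff G A l) x y"

text \<open>When the compatibilities hold, this is \<ell> applied to the counting identity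
  \<open>card_k2_k1_cocycle\<close>. Otherwise \<open>compatible_assoc\<close> makes both sides
  vanish.\<close>

lemma subchar_coeff_cocycle:
  assumes s: "s \<in> subcharacters G A" and t: "t \<in> subcharacters G A" and u: "u \<in> subcharacters G A"
  shows "subchar_coeff G A l s t * subchar_coeff G A l (star_subchar G A s t) u =
    subchar_coeff G A l t u * subchar_coeff G A l s (star_subchar G A t u)"
proof (cases "compatible G A s t \<and> compatible G A (star_subchar G A s t) u")
  case True
  have sub: "subgroup (fst s) (G \<times>\<times> G)" "subgroup (fst t) (G \<times>\<times> G)" "subgroup (fst u) (G \<times>\<times> G)"
    using s t u by (auto simp: subcharacters_def)
  have l_mult: "l (m * n) = l m * l n" if "m > 0" "n > 0" for m n
    using l that by (simp add: pos_monoid_hom_def)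
  have "l (card (k2 G (fst s) \<inter> k1 G (fst t))) * l (card (k2 G (star_prod G (fst s) (fst t)) \<inter> k1 G (fst u))) =
      l (card (k2 G (fst t) \<inter> k1 G (fst u))) * l (card (k2 G (fst s) \<inter> k1 G (star_prod G (fst t) (fst u))))"
    using card_k2_k1_cocycle[OF sub]
    by (simp add: l_mult[symmetric] card_k2_k1_pos subgroup_star_prod sub)
  then show ?thesis
    using True compatible_assoc[OF s t u] by (simp add: subchar_coeff_def star_subchar_def)
next
  case False
  then show ?thesis
    using compatible_assoc[OF s t u] by (auto simp: subchar_coeff_def)
qed

lemma subchar_coeff_nonzeroD: "subchar_coeff G A l s t \<noteq> 0 \<Longrightarrow> compatible G A s t"
  by (simp add: subchar_coeff_def split: if_splits)

lemma mult_assoc: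
  assumes "Poly_Mapping.keys x \<subseteq> subcharacters G A" "Poly_Mapping.keys y \<subseteq> subcharacters G A"
    "Poly_Mapping.keys z \<subseteq> subcharacters G A"
  shows "(x \<star> y) \<star> z = x \<star> (y \<star> z)"
proof (rule twisted_mult_assoc[OF subchar_coeff_cocycle _ assms])
  fix s t u
  assume "s \<in> subcharacters G A" "t \<in> subcharacters G A" "u \<in> subcharacters G A"
    and "subchar_coeff G A l s t * subchar_coeff G A l (star_subchar G A s t) u \<noteq> 0"
  then show "star_subchar G A (star_subchar G A s t) u = star_subchar G A s (star_subchar G A t u)"
    by (intro star_subchar_assoc) (auto dest: subchar_coeff_nonzeroD)
qed

lemma keys_mult:
  assumes "Poly_Mapping.keys x \<subseteq> subcharacters G A" "Poly_Mapping.keys y \<subseteq> subcharacters G A"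
  shows "Poly_Mapping.keys (x \<star> y) \<subseteq> subcharacters G A"
  using assms by (intro keys_twisted_mult) (auto intro!: star_subchar_closed dest: subchar_coeff_nonzeroD)

lemma keys_mult_left:
  assumes "Poly_Mapping.keys x \<subseteq> subcharacters G A" "Poly_Mapping.keys y \<subseteq> left_subcharacters G A"
  shows "Poly_Mapping.keys (x \<star> y) \<subseteq> left_subcharacters G A"
  using assms by (intro keys_twisted_mult) (auto intro!: star_subchar_left_closed dest: subchar_coeff_nonzeroD)

lemma subchar_coeff_diag:
  assumes "s \<in> subcharacters G A"
  shows "subchar_coeff G A l (diag_subchar G A) s = 1" "subchar_coeff G A l s (diag_subchar G A) = 1"
proof -
  obtain U \<phi> where [simp]: "s = (U, \<phi>)" by (metis surj_pair)
  have "k1 G U \<inter> {\<one>} = {\<one>}" "k2 G U \<inter> {\<one>} = {\<one>}"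
    using subchar_one_closed assms by (auto simp: k1_def k2_def)
  then show "subchar_coeff G A l (diag_subchar G A) s = 1" "subchar_coeff G A l s (diag_subchar G A) = 1"
    using compatible_diag[OF assms] l
    by (simp_all add: subchar_coeff_def k1_diag k2_diag pos_monoid_hom_def Int_commute)
qed

lemma mult_diag:
  assumes "Poly_Mapping.keys x \<subseteq> subcharacters G A"
  shows "Poly_Mapping.single (diag_subchar G A) 1 \<star> x = x" "x \<star> Poly_Mapping.single (diag_subchar G A) 1 = x"
proof -
  let ?d = "Poly_Mapping.single (diag_subchar G A) (1::'k)"
  \<comment> \<open>\<open>x\<close> occurs again inside its own expansion, so the identities are
    proved for the expanded form and folded back at the end.\<close>
  let ?x = "\<Sum>s\<in>Poly_Mapping.keys x. Poly_Mapping.single s (Poly_Mapping.lookup x s)"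
  have "?d \<star> ?x = ?x" "?x \<star> ?d = ?x"
    unfolding twisted_mult_sum_right twisted_mult_sum_left twisted_mult_single
    by (intro sum.cong refl; use assms in \<open>auto simp: subchar_coeff_diag star_subchar_diag\<close>)+
  then show "?d \<star> x = x" "x \<star> ?d = x"
    by (simp_all flip: poly_mapping_sum_single)
qed

lemma subchar_algebra_simps:
  "carrier (subchar_algebra G A l) = {x. Poly_Mapping.keys x \<subseteq> subcharacters G A}"
  "x \<otimes>\<^bsub>subchar_algebra G A l\<^esub> y = x \<star> y"
  "\<one>\<^bsub>subchar_algebra G A l\<^esub> = Poly_Mapping.single (diag_subchar G A) 1"
  "\<zero>\<^bsub>subchar_algebra G A l\<^esub> = 0"
  "x \<oplus>\<^bsub>subchar_algebra G A l\<^esub> y = x + y"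
  by (simp_all add: subchar_algebra_def subchar_mult_eq_twisted_mult)

lemma S11_simps:
  "carrier (S11 G A l) = {x. Poly_Mapping.keys x \<subseteq> left_subcharacters G A}"
  "x \<odot>\<^bsub>S11 G A l\<^esub> y = x \<star> y"
  "\<zero>\<^bsub>S11 G A l\<^esub> = 0"
  "x \<oplus>\<^bsub>S11 G A l\<^esub> y = x + y"
  by (simp_all add: S11_def regular_left_module_def subchar_algebra_simps)

lemma keys_add_subset: "\<lbrakk>Poly_Mapping.keys x \<subseteq> B; Poly_Mapping.keys y \<subseteq> B\<rbrakk> \<Longrightarrow> Poly_Mapping.keys (x + y) \<subseteq> B"
  using keys_add[of x y] by blast

lemma keys_uminus: "Poly_Mapping.keys (- x) = Poly_Mapping.keys (x :: 'b \<Rightarrow>\<^sub>0 'k)"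
  by (rule Set.set_eqI) (simp add: in_keys_iff)

lemma ring_subchar_algebra: "ring (subchar_algebra G A l)"
proof (rule ringI)
  show "abelian_group (subchar_algebra G A l)"
  proof (rule abelian_groupI)
    fix x assume "x \<in> carrier (subchar_algebra G A l)"
    then show "\<exists>y\<in>carrier (subchar_algebra G A l). y \<oplus>\<^bsub>subchar_algebra G A l\<^esub> x = \<zero>\<^bsub>subchar_algebra G A l\<^esub>"
      by (intro bexI[of _ "- x"]) (simp_all add: subchar_algebra_simps keys_uminus)
  qed (simp_all add: subchar_algebra_simps keys_add_subset add_ac)
  show "monoid (subchar_algebra G A l)"
    by (rule monoidI) (simp_all add: subchar_algebra_simps keys_mult mult_diag mult_assoc diag_subchar_closed)
qed (simp_all add: subchar_algebra_simps twisted_mult_add_left twisted_mult_add_right)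

lemma left_module_S11: "left_module (subchar_algebra G A l) (S11 G A l)"
proof -
  have M: "abelian_group (S11 G A l)"
  proof (rule abelian_groupI)
    fix x assume "x \<in> carrier (S11 G A l)"
    then show "\<exists>y\<in>carrier (S11 G A l). y \<oplus>\<^bsub>S11 G A l\<^esub> x = \<zero>\<^bsub>S11 G A l\<^esub>"
      by (intro bexI[of _ "- x"]) (simp_all add: S11_simps keys_uminus)
  qed (simp_all add: S11_simps keys_add_subset add_ac)
  have sub: "Poly_Mapping.keys (x :: ('g, 'a) subchar \<Rightarrow>\<^sub>0 'k) \<subseteq> subcharacters G A"
    if "Poly_Mapping.keys x \<subseteq> left_subcharacters G A" for x
    using that left_subcharacters_subset by blast
  have "left_module_axioms (subchar_algebra G A l) (S11 G A l)"
    by (rule left_module_axioms.intro)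
      (simp_all add: S11_simps subchar_algebra_simps keys_mult_left mult_diag mult_assoc sub
        twisted_mult_add_left twisted_mult_add_right)
  with M ring_subchar_algebra show ?thesis
    by (simp add: left_module_def)
qed

text \<open>Every basis vector in the support is sent to a multiple of the same basis vector
  \<open>left_subchar r\<close>. Hence the product collapses to a single term, whose coefficient
  pairs \<open>s\<close> with \<open>x\<close> under the agreement form.\<close>

lemma product_subchar_mult:
  assumes r: "r \<in> char_pairs" and s: "s \<in> char_pairs" and T: "finite T" "T \<subseteq> char_pairs"
    and x: "Poly_Mapping.keys x \<subseteq> left_subchar ` T"
  shows "Poly_Mapping.single (product_subchar r s) a \<star> x =
    Poly_Mapping.single (left_subchar r)
      (a * (\<Sum>t\<in>T. agreement_form l s t * Poly_Mapping.lookup x (left_subchar t)))"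
proof -
  have inj: "inj_on left_subchar T"
    using inj_on_left_subchar T(2) by (rule inj_on_subset)
  have "Poly_Mapping.single (product_subchar r s) a \<star> x =
      (\<Sum>u\<in>{product_subchar r s}. \<Sum>t\<in>left_subchar ` T. Poly_Mapping.single (star_subchar G A u t)
        (Poly_Mapping.lookup (Poly_Mapping.single (product_subchar r s) a) u * Poly_Mapping.lookup x t *
          subchar_coeff G A l u t))"
    by (rule twisted_mult_superset) (use T x in auto)
  also have "\<dots> = (\<Sum>t\<in>T. Poly_Mapping.single (star_subchar G A (product_subchar r s) (left_subchar t))
        (a * Poly_Mapping.lookup x (left_subchar t) * agreement_form l s t))"
    by (simp add: sum.reindex[OF inj])
      (rule sum.cong, simp, simp add: subchar_coeff_product_subchar[OF r s] subsetD[OF T(2)])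
  also have "\<dots> = (\<Sum>t\<in>T. Poly_Mapping.single (left_subchar r)
        (a * Poly_Mapping.lookup x (left_subchar t) * agreement_form l s t))"
  proof (rule sum.cong[OF refl])
    fix t assume "t \<in> T"
    then have t: "t \<in> char_pairs" using T by auto
    show "Poly_Mapping.single (star_subchar G A (product_subchar r s) (left_subchar t))
        (a * Poly_Mapping.lookup x (left_subchar t) * agreement_form l s t) = Poly_Mapping.single (left_subchar r)
        (a * Poly_Mapping.lookup x (left_subchar t) * agreement_form l s t)"
    proof (cases "compatible G A (product_subchar r s) (left_subchar t)")
      case True
      then show ?thesis
        using star_product_subchar_left_subchar[OF r s t] by simp
    next
      \<comment> \<open>Here the basis vector on the left may differ from
        \<open>left_subchar r\<close>, but its coefficient is zero.\<close>
      case False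
      then have "agreement_form l s t = 0"
        using subchar_coeff_product_subchar[OF r s t, of l] by (simp add: subchar_coeff_def)
      then show ?thesis
        by simp
    qed
  qed
  also have "\<dots> = Poly_Mapping.single (left_subchar r)
      (\<Sum>t\<in>T. a * Poly_Mapping.lookup x (left_subchar t) * agreement_form l s t)"
    using T(1) by (induction T) (simp_all add: single_add)
  also have "(\<Sum>t\<in>T. a * Poly_Mapping.lookup x (left_subchar t) * agreement_form l s t) =
      a * (\<Sum>t\<in>T. agreement_form l s t * Poly_Mapping.lookup x (left_subchar t))"
    by (simp add: sum_distrib_left ac_simps)
  finally show ?thesis .
qed

text \<open>The trivial subgroup with its trivial character supplies a basis vector.\<close>

lemma S11_carrier_nontrivial: "carrier (S11 G A l) \<noteq> {\<zero>\<^bsub>S11 G A l\<^esub>}"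
proof -
  have "({\<one>}, restrict (\<lambda>_. \<one>\<^bsub>A\<^esub>) {\<one>}) \<in> char_pairs"
    using triv_subgroup by (simp add: char_pairs_iff)
  then obtain s where "s \<in> left_subcharacters G A"
    using left_subcharacters_eq_image by blast
  then have "Poly_Mapping.single s 1 \<in> carrier (S11 G A l)"
    by (simp add: S11_simps)
  moreover have "Poly_Mapping.single s (1::'k) \<noteq> 0"
    by (metis lookup_single_eq lookup_zero zero_neq_one)
  ultimately show ?thesis
    by (auto simp: S11_simps)
qed

end

section \<open>Simplicity: any nonzero element generates the module\<close>

theorem lemma3p1:
  fixes G :: "('g, 'x) monoid_scheme"
    and A :: "('a, 'y) monoid_scheme"
    and l :: "nat \<Rightarrow> 'k::field_char_0"
  assumes "has_all_primitive_roots_of_unity TYPE('k)"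
    and "group G" and "finite (carrier G)"
    and "comm_group A"
    and "pos_monoid_hom l"
    and "alg_independent_wrt l G"
  shows "simple_left_module (subchar_algebra G A l) (S11 G A l)"
proof -
  interpret deformed_subchar_algebra G A l
    by (intro deformed_subchar_algebra.intro subchar_groups.intro subchar_groups_axioms.intro
        deformed_subchar_algebra_axioms.intro assms)
  have "N = carrier (S11 G A l)"
    if N: "submodule N (subchar_algebra G A l) (S11 G A l)" and N0: "N \<noteq> {\<zero>\<^bsub>S11 G A l\<^esub>}" for N
  proof -
    interpret N: submodule N "subchar_algebra G A l" "S11 G A l" by fact
    have sub: "N \<subseteq> carrier (S11 G A l)" and zero: "0 \<in> N" and add: "\<And>x y. x \<in> N \<Longrightarrow> y \<in> N \<Longrightarrow> x + y \<in> N"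
      using N.subset N.one_closed N.m_closed by (simp_all add: S11_simps)
    have smult: "x \<star> y \<in> N" if "Poly_Mapping.keys x \<subseteq> subcharacters G A" "y \<in> N" for x y
      using N.smult_closed that by (simp add: S11_simps subchar_algebra_simps)
    obtain x where x: "x \<in> N" "x \<noteq> 0"
      using N0 zero by (auto simp: S11_simps)
    \<comment> \<open>The support of \<open>x\<close>, pulled back to pairs; it is finite because
      \<open>left_subchar\<close> is injective on \<open>char_pairs\<close>.\<close>
    define T where "T = left_subchar -` Poly_Mapping.keys x \<inter> char_pairs"
    have "finite T"
      unfolding T_def using inj_on_left_subchar by (intro finite_vimage_IntI) auto
    have "Poly_Mapping.keys x \<subseteq> left_subchar ` char_pairs"
      using x sub by (auto simp: S11_simps left_subcharacters_eq_image)
    then have T: "T \<subseteq> char_pairs" "Poly_Mapping.keys x \<subseteq> left_subchar ` T"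
      unfolding T_def by blast+
    \<comment> \<open>Otherwise the coefficients of \<open>x\<close> would lie in the kernel of the
      form on the finite set \<open>T\<close>, and nondegeneracy would give
      \<open>x = 0\<close>.\<close>
    have "\<exists>s\<in>T. (\<Sum>t\<in>T. agreement_form l s t * Poly_Mapping.lookup x (left_subchar t)) \<noteq> 0"
    proof (rule ccontr)
      assume *: "\<not> ?thesis"
      have "Poly_Mapping.lookup x (left_subchar t) = 0" if "t \<in> T" for t
      proof (rule agreement_form_nondegenerate[OF assms(2,3,5,6) \<open>finite T\<close> _ _ that,
            where x = "\<lambda>t. Poly_Mapping.lookup x (left_subchar t)"])
        show "subgroup (fst s) G \<and> snd s \<in> extensional (fst s)" if "s \<in> T" for s
          using that T(1) by (cases s) (auto simp: char_pairs_iff)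
        show "(\<Sum>t\<in>T. agreement_form l s t * Poly_Mapping.lookup x (left_subchar t)) = 0" if "s \<in> T" for s
          using * that by blast
      qed
      then have "\<forall>u\<in>left_subchar ` T. Poly_Mapping.lookup x u = 0"
        by blast
      then have "Poly_Mapping.keys x = {}"
        using T(2) by (meson all_not_in_conv in_keys_iff subsetD)
      then show False
        using x by simp
    qed
    then obtain s c where s: "s \<in> char_pairs"
      and c: "c = (\<Sum>t\<in>T. agreement_form l s t * Poly_Mapping.lookup x (left_subchar t))" "c \<noteq> 0"
      using T(1) by blast
    \<comment> \<open>With \<open>s\<close> fixed, the first factor \<open>r\<close> of the product
      subcharacter is still free, so every basis vector is reached; the scalar \<open>b / c\<close>
      normalises the coefficient.\<close>
    have single: "Poly_Mapping.single u b \<in> N" if u: "u \<in> left_subcharacters G A" for u b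
    proof -
      obtain r where r: "r \<in> char_pairs" "u = left_subchar r"
        using u by (auto simp: left_subcharacters_eq_image)
      have "Poly_Mapping.single (product_subchar r s) (b / c) \<star> x = Poly_Mapping.single u b"
        using product_subchar_mult[OF r(1) s \<open>finite T\<close> T, of "b / c"] c r(2) by simp
      moreover have "Poly_Mapping.single (product_subchar r s) (b / c) \<star> x \<in> N"
        using product_subchar_closed[OF r(1) s] x by (intro smult) auto
      ultimately show ?thesis
        by simp
    qed
    have "y \<in> N" if y: "y \<in> carrier (S11 G A l)" for y
    proof -
      \<comment> \<open>Stated for arbitrary finite \<open>K\<close> so that induction applies; it
        is used with the support of \<open>y\<close>.\<close>
      have "(\<Sum>u\<in>K. Poly_Mapping.single u (Poly_Mapping.lookup y u)) \<in> N"
        if "finite K" "K \<subseteq> left_subcharacters G A" for K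
        using that by (induction K) (auto simp: zero intro!: add single)
      then show ?thesis
        using y by (subst poly_mapping_sum_single) (simp add: S11_simps)
    qed
    then show ?thesis
      using sub by blast
  qed
  then show ?thesis
    using left_module_S11 S11_carrier_nontrivial unfolding simple_left_module_def by blast
qed

end
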